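(* Let $\Sigma\subset\mathbb{T}$ be a globally convex congruence with only isolated shear-free lines. Then the total number of shear-free lines of $\Sigma$, counted with index, is $4$.
   Context: Oriented lines. The space of oriented lines in $\mathbb{R}^3$ is $\mathbb{T}=\{(\vec U,\vec W)\in\mathbb{R}^3\times\mathbb{R}^3 : \langle\vec U,\vec W\rangle=0,\ |\vec W|=1\}\cong TS^2=T\mathbb{P}^1$; the pair $(\vec U,\vec W)$ is the oriented line $\{\vec U+r\vec W: r\in\mathbb{R}\}$, and $\pi(\vec U,\vec W)=\vec W\in S^2=\mathbb{P}^1$. A line congruence is a smooth (immersed) real surface $\Sigma\subset\mathbb{T}$. It is globally convex if it is the graph of a global smooth section of $\pi:\mathbb{T}\to\mathbb{P}^1$; it is then given the graph orientation, for which $\pi|_\Sigma:\Sigma\to\mathbb{P}^1$ is orientation preserving (with $\mathbb{P}^1$ oriented by the complex coordinate $\xi$ below). Coordinates. Let $\xi$ be the holomorphic coordinate on $\mathbb{P}^1=S^2$ given by stereographic projection from the South pole (so $\vec W$ has $x^1+ix^2$ component $\frac{2\xi}{1+\xi\bar\xi}$ and $x^3$ component $\frac{1-\xi\bar\xi}{1+\xi\bar\xi}$). The point $F\frac{\partial}{\partial\xi}\in T_\xi\mathbb{P}^1$ has coordinates $(\xi,F)$ and corresponds to the oriented line, parametrised by arclength $r$, $$x^1+ix^2=\frac{2(F-\bar F\xi^2)+2\xi(1+\xi\bar\xi)r}{(1+\xi\bar\xi)^2},\qquad x^3=\frac{-2(F\bar\xi+\bar F\xi)+(1-\xi^2\bar\xi^2)r}{(1+\xi\bar\xi)^2}.$$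 A congruence is locally parametrised by smooth functions $\xi(u,v),F(u,v)$ of real parameters $u,v$, with $(u,v)$ compatible with the orientation of $\Sigma$. (Lines in the South pole direction are treated after a rotation of $\mathbb{R}^3$.) Put $\nu=u+iv$, $\partial=\partial/\partial\nu$, $\bar\partial=\partial/\partial\bar\nu$, and $$\partial^+F=\partial F+r\,\partial\xi-\frac{2F\bar\xi\,\partial\xi}{1+\xi\bar\xi},\qquad \partial^-F=\bar\partial F+r\,\bar\partial\xi-\frac{2F\bar\xi\,\bar\partial\xi}{1+\xi\bar\xi},$$ $$\Delta=\frac{4}{(1+\xi\bar\xi)^2}\left(\partial^+F\,\overline{\partial^+F}-\partial^-F\,\overline{\partial^-F}\right).$$ Shear. At points $(u,v,r)$ with $\Delta\ne0$ the shear is $$\sigma=\frac{\overline{\partial^+F}\,\partial\bar\xi-\overline{\partial^-F}\,\bar\partial\bar\xi}{\partial^-F\,\overline{\partial^-F}-\partial^+F\,\overline{\partial^+F}}.$$ A line $\gamma\in\Sigma$ is shear-free if $\sigma=0$ at the points of $\gamma$ where $\Delta\neq0$ (if $\sigma$ vanishes at one such point of $\gamma$ it vanishes at all of them). Index. Let $\gamma_0\in\Sigma$ be an isolated shear-free line and fix $r=r_0$ with $\Delta\neq0$ at the corresponding point of $\gamma_0$. The index of $\gamma_0$ is minus the winding number about $0$ of the complex function $\sigma(\cdot,r_0)$ along a small positively oriented loop in $\Sigma$ around $\gamma_0$ (equivalently, the winding number of $\bar\sigma$). *)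

theory Defs
  imports "HOL-Complex_Analysis.Complex_Analysis"
begin

section \<open>Smooth maps\<close>

fun times_cont_diff_on ::
    "nat \<Rightarrow> ('a::euclidean_space \<Rightarrow> 'b::real_normed_vector) \<Rightarrow> 'a set \<Rightarrow> bool" where
  "times_cont_diff_on 0 f N = continuous_on N f"
| "times_cont_diff_on (Suc k) f N =
     ((\<forall>x\<in>N. f differentiable (at x)) \<and>
      (\<forall>v. times_cont_diff_on k (\<lambda>x. frechet_derivative f (at x) v) N))"

text \<open>
  Smoothness on an arbitrary subset: locally the restriction of a smooth map defined on an open set
  of the ambient space. On open sets this is ordinary smoothness, on the unit sphere it is
  smoothness with respect to its submanifold structure.
\<close>

definition smooth_on :: "'a::euclidean_space set \<Rightarrow> ('a \<Rightarrow> 'b::real_normed_vector) \<Rightarrow> bool" where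
  "smooth_on S f \<longleftrightarrow>
     (\<forall>x\<in>S. \<exists>N g. open N \<and> x \<in> N \<and> (\<forall>k. times_cont_diff_on k g N) \<and> (\<forall>y\<in>S \<inter> N. f y = g y))"

section \<open>Oriented lines and globally convex congruences\<close>

text \<open>The pair \<open>(U, W)\<close> stands for the oriented line \<open>{U + r W | r real}\<close>.\<close>

type_synonym line = "(real^3) \<times> (real^3)"

definition oriented_lines :: "line set" where
  "oriented_lines = {(U, W). U \<bullet> W = 0 \<and> norm W = 1}"

definition globally_convex :: "line set \<Rightarrow> bool" where
  "globally_convex \<Sigma> \<longleftrightarrow>
     (\<exists>s. smooth_on (sphere 0 1) s \<and>
          (\<forall>W\<in>sphere 0 1. s W \<in> oriented_lines \<and> snd (s W) = W) \<and>
          \<Sigma> = s ` sphere 0 1)"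

section \<open>The coordinates\<close>

definition line_point :: "complex \<Rightarrow> complex \<Rightarrow> real \<Rightarrow> real^3" where
  "line_point \<xi> F r =
     (let z = (2 * (F - cnj F * \<xi>\<^sup>2) + 2 * \<xi> * (1 + \<xi> * cnj \<xi>) * of_real r) / (1 + \<xi> * cnj \<xi>)\<^sup>2;
          h = (- 2 * (F * cnj \<xi> + cnj F * \<xi>) + (1 - \<xi>\<^sup>2 * (cnj \<xi>)\<^sup>2) * of_real r) / (1 + \<xi> * cnj \<xi>)\<^sup>2
      in vector [Re z, Im z, Re h])"

definition line_direction :: "complex \<Rightarrow> real^3" where
  "line_direction \<xi> =
     (let z = 2 * \<xi> / (1 + \<xi> * cnj \<xi>);
          h = (1 - \<xi> * cnj \<xi>) / (1 + \<xi> * cnj \<xi>)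
      in vector [Re z, Im z, Re h])"

text \<open>
  The line with coordinates \<open>(\<xi>, F)\<close>; the point with \<open>r = 0\<close> is the one closest to the origin.
\<close>

definition line_of :: "complex \<Rightarrow> complex \<Rightarrow> line" where
  "line_of \<xi> F = (line_point \<xi> F 0, line_direction \<xi>)"

lemma one_plus_mult_cnj: "1 + \<xi> * cnj \<xi> = of_real (1 + (Re \<xi>)\<^sup>2 + (Im \<xi>)\<^sup>2)"
  by (simp add: complex_mult_cnj)

lemma one_plus_squares_neq_0: "1 + (x::real)\<^sup>2 + y\<^sup>2 \<noteq> 0"
  by (metis add_pos_nonneg less_numeral_extra(3) sum_power2_ge_zero add.assoc zero_less_one)

lemma line_point_eq: "line_point \<xi> F r = fst (line_of \<xi> F) + r *\<^sub>R snd (line_of \<xi> F)"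
proof -
  have nz: "1 + \<xi> * cnj \<xi> \<noteq> 0"
    unfolding one_plus_mult_cnj of_real_eq_0_iff by (rule one_plus_squares_neq_0)
  have z: "(a + 2 * \<xi> * (1 + \<xi> * cnj \<xi>) * of_real r) / (1 + \<xi> * cnj \<xi>)\<^sup>2
        = a / (1 + \<xi> * cnj \<xi>)\<^sup>2 + of_real r * (2 * \<xi> / (1 + \<xi> * cnj \<xi>))" for a
    using nz by (simp add: add_divide_distrib power2_eq_square)
  have h: "(a + (1 - \<xi>\<^sup>2 * (cnj \<xi>)\<^sup>2) * of_real r) / (1 + \<xi> * cnj \<xi>)\<^sup>2
        = a / (1 + \<xi> * cnj \<xi>)\<^sup>2 + of_real r * ((1 - \<xi> * cnj \<xi>) / (1 + \<xi> * cnj \<xi>))" for a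
  proof -
    have "(1 - \<xi>\<^sup>2 * (cnj \<xi>)\<^sup>2) = (1 - \<xi> * cnj \<xi>) * (1 + \<xi> * cnj \<xi>)"
      by (simp add: algebra_simps power2_eq_square)
    then have "(1 - \<xi>\<^sup>2 * (cnj \<xi>)\<^sup>2) / (1 + \<xi> * cnj \<xi>)\<^sup>2 = (1 - \<xi> * cnj \<xi>) / (1 + \<xi> * cnj \<xi>)"
      using nz by (simp add: power2_eq_square)
    then show ?thesis
      by (simp only: add_divide_distrib) (metis mult.commute times_divide_eq_right)
  qed
  show ?thesis
    unfolding line_of_def line_point_def line_direction_def Let_def z h
    by (simp add: vec_eq_iff forall_3 del: times_divide_eq_right)
qed

lemma line_of_in_oriented_lines: "line_of \<xi> F \<in> oriented_lines"
proof -
  define a b p q d where "a = Re \<xi>" "b = Im \<xi>" "p = Re F" "q = Im F" "d = 1 + a\<^sup>2 + b\<^sup>2"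
  note defs = this
  have \<xi>: "\<xi> = Complex a b" and F: "F = Complex p q" by (simp_all add: defs)
  have d: "1 + \<xi> * cnj \<xi> = of_real d" "(1 + \<xi> * cnj \<xi>)\<^sup>2 = of_real (d\<^sup>2)"
    by (simp_all add: defs one_plus_mult_cnj)
  have nz: "d \<noteq> 0" unfolding defs by (rule one_plus_squares_neq_0)
  have "snd (line_of \<xi> F) \<bullet> snd (line_of \<xi> F) = ((2*a)\<^sup>2 + (2*b)\<^sup>2 + (2 - d)\<^sup>2) / d\<^sup>2"
    unfolding line_of_def line_direction_def Let_def d snd_conv inner_vec_def sum_3
    by (simp add: \<xi> d nz defs(5) power2_eq_square add_divide_distrib [symmetric] algebra_simps)
  also have "(2*a)\<^sup>2 + (2*b)\<^sup>2 + (2 - d)\<^sup>2 = d\<^sup>2"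
    by (simp add: defs(5) power2_eq_square algebra_simps)
  finally have "norm (snd (line_of \<xi> F)) = 1"
    using nz by (simp add: norm_eq_sqrt_inner)
  moreover have "fst (line_of \<xi> F) \<bullet> snd (line_of \<xi> F) =
     ((2 * (p - (p * (a\<^sup>2 - b\<^sup>2) + q * (2*a*b)))) * (2*a)
      + (2 * (q - (p * (2*a*b) - q * (a\<^sup>2 - b\<^sup>2)))) * (2*b)
      + (- 4 * (p*a + q*b)) * (1 - a\<^sup>2 - b\<^sup>2)) / (d\<^sup>2 * d)"
    unfolding line_of_def line_point_def line_direction_def Let_def d snd_conv fst_conv inner_vec_def sum_3
    by (simp add: \<xi> F power2_eq_square add_divide_distrib [symmetric] algebra_simps)
  moreover have "(2 * (p - (p * (a\<^sup>2 - b\<^sup>2) + q * (2*a*b)))) * (2*a)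
      + (2 * (q - (p * (2*a*b) - q * (a\<^sup>2 - b\<^sup>2)))) * (2*b)
      + (- 4 * (p*a + q*b)) * (1 - a\<^sup>2 - b\<^sup>2) = 0"
    by (simp add: power2_eq_square algebra_simps)
  ultimately show ?thesis
    unfolding oriented_lines_def by (simp add: case_prod_unfold)
qed

section \<open>The shear of a parametrised congruence\<close>

definition dnu :: "(complex \<Rightarrow> complex) \<Rightarrow> complex \<Rightarrow> complex" where
  "dnu f \<nu> = (frechet_derivative f (at \<nu>) 1 - \<i> * frechet_derivative f (at \<nu>) \<i>) / 2"

definition dnubar :: "(complex \<Rightarrow> complex) \<Rightarrow> complex \<Rightarrow> complex" where
  "dnubar f \<nu> = (frechet_derivative f (at \<nu>) 1 + \<i> * frechet_derivative f (at \<nu>) \<i>) / 2"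

definition dplus ::
    "(complex \<Rightarrow> complex) \<Rightarrow> (complex \<Rightarrow> complex) \<Rightarrow> real \<Rightarrow> complex \<Rightarrow> complex" where
  "dplus \<xi> F r \<nu> =
     dnu F \<nu> + of_real r * dnu \<xi> \<nu> - 2 * F \<nu> * cnj (\<xi> \<nu>) * dnu \<xi> \<nu> / (1 + \<xi> \<nu> * cnj (\<xi> \<nu>))"

definition dminus ::
    "(complex \<Rightarrow> complex) \<Rightarrow> (complex \<Rightarrow> complex) \<Rightarrow> real \<Rightarrow> complex \<Rightarrow> complex" where
  "dminus \<xi> F r \<nu> =
     dnubar F \<nu> + of_real r * dnubar \<xi> \<nu>
       - 2 * F \<nu> * cnj (\<xi> \<nu>) * dnubar \<xi> \<nu> / (1 + \<xi> \<nu> * cnj (\<xi> \<nu>))"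

definition Delta ::
    "(complex \<Rightarrow> complex) \<Rightarrow> (complex \<Rightarrow> complex) \<Rightarrow> real \<Rightarrow> complex \<Rightarrow> complex" where
  "Delta \<xi> F r \<nu> =
     4 / (1 + \<xi> \<nu> * cnj (\<xi> \<nu>))\<^sup>2 *
       (dplus \<xi> F r \<nu> * cnj (dplus \<xi> F r \<nu>) - dminus \<xi> F r \<nu> * cnj (dminus \<xi> F r \<nu>))"

text \<open>Meaningful only where \<open>Delta \<xi> F r \<nu> \<noteq> 0\<close>.\<close>

definition shear ::
    "(complex \<Rightarrow> complex) \<Rightarrow> (complex \<Rightarrow> complex) \<Rightarrow> real \<Rightarrow> complex \<Rightarrow> complex" where
  "shear \<xi> F r \<nu> =
     (cnj (dplus \<xi> F r \<nu>) * dnu (\<lambda>z. cnj (\<xi> z)) \<nu>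
        - cnj (dminus \<xi> F r \<nu>) * dnubar (\<lambda>z. cnj (\<xi> z)) \<nu>) /
     (dminus \<xi> F r \<nu> * cnj (dminus \<xi> F r \<nu>) - dplus \<xi> F r \<nu> * cnj (dplus \<xi> F r \<nu>))"

section \<open>Shear-free lines and their index\<close>

text \<open>
  Local parametrisations of a globally convex congruence around the line \<open>\<gamma>\<close> that are compatible
  with the graph orientation. The projection to the sphere is \<open>\<xi>\<close> in coordinates, and it is an
  orientation preserving local diffeomorphism on the graph, so being an immersion compatible with
  the orientation amounts to positivity of the Jacobian determinant \<open>|dnu \<xi>|\<^sup>2 - |dnubar \<xi>|\<^sup>2\<close>.
\<close>

definition oriented_parametrisation ::
    "line set \<Rightarrow> line \<Rightarrow> complex set \<Rightarrow> complex \<Rightarrow> (complex \<Rightarrow> complex) \<Rightarrow> (complex \<Rightarrow> complex) \<Rightarrow> bool" where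
  "oriented_parametrisation \<Sigma> \<gamma> D \<nu>\<^sub>0 \<xi> F \<longleftrightarrow>
     open D \<and> \<nu>\<^sub>0 \<in> D \<and> smooth_on D \<xi> \<and> smooth_on D F \<and>
     line_of (\<xi> \<nu>\<^sub>0) (F \<nu>\<^sub>0) = \<gamma> \<and>
     inj_on (\<lambda>\<nu>. line_of (\<xi> \<nu>) (F \<nu>)) D \<and>
     openin (top_of_set \<Sigma>) ((\<lambda>\<nu>. line_of (\<xi> \<nu>) (F \<nu>)) ` D) \<and>
     (\<forall>\<nu>\<in>D. (cmod (dnu \<xi> \<nu>))\<^sup>2 - (cmod (dnubar \<xi> \<nu>))\<^sup>2 > 0)"

text \<open>
  Lines in the South pole direction have no coordinates \<open>(\<xi>, F)\<close>. They, together with the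
  congruence, are first rotated by the half-turn about the first axis, which exchanges the poles
  (\<open>\<xi> \<mapsto> 1 / \<xi>\<close>). A rotation changes the shear only by a continuous phase factor, so the choice of
  rotation is immaterial both for its vanishing and for the index.
\<close>

definition south :: "real^3" where
  "south = vector [0, 0, -1]"

definition half_turn :: "real^3 \<Rightarrow> real^3" where
  "half_turn x = vector [x $ 1, - x $ 2, - x $ 3]"

definition chart_rotation :: "line \<Rightarrow> line \<Rightarrow> line" where
  "chart_rotation \<gamma> = (if snd \<gamma> = south then map_prod half_turn half_turn else id)"

definition parametrisation_around ::
    "line set \<Rightarrow> line \<Rightarrow> complex set \<Rightarrow> complex \<Rightarrow> (complex \<Rightarrow> complex) \<Rightarrow> (complex \<Rightarrow> complex) \<Rightarrow> bool" where
  "parametrisation_around \<Sigma> \<gamma> D \<nu>\<^sub>0 \<xi> F \<longleftrightarrow>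
     oriented_parametrisation (chart_rotation \<gamma> ` \<Sigma>) (chart_rotation \<gamma> \<gamma>) D \<nu>\<^sub>0 \<xi> F"

definition shear_free :: "line set \<Rightarrow> line \<Rightarrow> bool" where
  "shear_free \<Sigma> \<gamma> \<longleftrightarrow>
     (\<forall>D \<nu>\<^sub>0 \<xi> F r. parametrisation_around \<Sigma> \<gamma> D \<nu>\<^sub>0 \<xi> F \<and> Delta \<xi> F r \<nu>\<^sub>0 \<noteq> 0 \<longrightarrow> shear \<xi> F r \<nu>\<^sub>0 = 0)"

definition shear_free_lines :: "line set \<Rightarrow> line set" where
  "shear_free_lines \<Sigma> = {\<gamma>\<in>\<Sigma>. shear_free \<Sigma> \<gamma>}"

text \<open>
  Minus the winding number of the shear at any admissible fixed \<open>r\<^sub>0\<close> along all sufficiently small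
  positively oriented circles, in any oriented parametrisation.
\<close>

definition has_shear_index :: "line set \<Rightarrow> line \<Rightarrow> int \<Rightarrow> bool" where
  "has_shear_index \<Sigma> \<gamma> k \<longleftrightarrow>
     (\<forall>D \<nu>\<^sub>0 \<xi> F r\<^sub>0. parametrisation_around \<Sigma> \<gamma> D \<nu>\<^sub>0 \<xi> F \<and> Delta \<xi> F r\<^sub>0 \<nu>\<^sub>0 \<noteq> 0 \<longrightarrow>
        (\<forall>\<^sub>F \<epsilon> in at_right 0. winding_number (shear \<xi> F r\<^sub>0 \<circ> circlepath \<nu>\<^sub>0 \<epsilon>) 0 = - of_int k))"

definition shear_index :: "line set \<Rightarrow> line \<Rightarrow> int" where
  "shear_index \<Sigma> \<gamma> = (THE k. has_shear_index \<Sigma> \<gamma> k)"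

end

theory Submission
  imports Defs
begin

text \<open>
  A globally convex congruence is a section of the tangent bundle of the sphere, given in the
  stereographic coordinate \<open>\<xi>\<close> by a smooth function \<open>F\<close>. The shear does not depend on the parameters
  (\<open>shear_reparametrise\<close>), and with \<open>\<xi>\<close> as parameter it is the conjugate of \<open>B = dnubar F\<close> divided by
  \<open>\<bar>dplus\<bar>\<^sup>2 - \<bar>B\<bar>\<^sup>2\<close>. So the shear-free lines are the zeros of \<open>B\<close>, and their index is the local
  winding number of \<open>B\<close> (\<open>shear_free_in_chart\<close>, \<open>shear_index_in_chart\<close>).

  Globally \<open>B\<close> is a section of the tangent bundle tensored with the antiholomorphic cotangent bundle,
  a complex line bundle of degree 2 + 2 = 4 over the sphere, and the theorem is the count of its
  zeros. Concretely, the half-turn that exchanges the poles provides a second chart \<open>w = 1 / \<xi>\<close>, in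
  which \<open>B\<close> becomes \<open>B' w = (w / cnj w)\<^sup>2 B (1 / w)\<close> (\<open>dnubar_half_turn\<close>). As the shear-free lines are
  isolated, all zeros of \<open>B\<close> lie inside some circle \<open>\<bar>\<xi>\<bar> = R\<close>, and by the argument principle for
  continuous functions (\<open>winding_number_eq_sum_zero_index\<close>) their indices add up to the winding number
  \<open>n\<close> of \<open>B\<close> on that circle. Seen from the other chart the circle runs backwards around \<open>w = 0\<close>, and the
  transition factor contributes 4, so that \<open>B'\<close> has winding number \<open>4 - n\<close> around \<open>w = 0\<close>
  (\<open>winding_number_transition\<close>). This is the index of the line in the South pole direction if that
  line is shear-free, and is 0 otherwise.

  That the index is well defined needs an admissible parametrisation, and the one by \<open>\<xi>\<close> is admissible
  because smoothness is stable under composition; the independence of the parametrisation rests on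
  \<open>winding_number_local_diffeomorphism\<close>.
\<close>

section \<open>Calculus of smooth maps\<close>

lemma frechet_derivative_eq_on_open:
  assumes "open N" "x \<in> N" "\<And>y. y \<in> N \<Longrightarrow> f y = g y"
  shows "frechet_derivative f (at x) = frechet_derivative g (at x)"
    and "f differentiable (at x) \<longleftrightarrow> g differentiable (at x)"
proof -
  have "(f has_derivative D) (at x) \<longleftrightarrow> (g has_derivative D) (at x)" for D
    using assms by (metis has_derivative_transform_within_open)
  then show "frechet_derivative f (at x) = frechet_derivative g (at x)"
    and "f differentiable (at x) \<longleftrightarrow> g differentiable (at x)"
    by (simp_all add: frechet_derivative_def differentiable_def)
qed

lemma times_cont_diff_on_cong:
  assumes "open N" "\<And>y. y \<in> N \<Longrightarrow> f y = g y"
  shows "times_cont_diff_on k f N \<longleftrightarrow> times_cont_diff_on k g N"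
  using assms(2)
proof (induction k arbitrary: f g)
  case 0
  then show ?case by (simp cong: continuous_on_cong)
next
  case (Suc k)
  have "frechet_derivative f (at x) = frechet_derivative g (at x)"
    "f differentiable (at x) \<longleftrightarrow> g differentiable (at x)" if "x \<in> N" for x
    using frechet_derivative_eq_on_open[OF assms(1) that Suc.prems] by auto
  then have "times_cont_diff_on k (\<lambda>x. frechet_derivative f (at x) v) N
      \<longleftrightarrow> times_cont_diff_on k (\<lambda>x. frechet_derivative g (at x) v) N" for v
    by (intro Suc.IH) simp
  with \<open>\<And>x. x \<in> N \<Longrightarrow> f differentiable (at x) \<longleftrightarrow> g differentiable (at x)\<close> show ?case by simp
qed

lemma times_cont_diff_on_subset:
  "times_cont_diff_on k f N \<Longrightarrow> M \<subseteq> N \<Longrightarrow> times_cont_diff_on k f M"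
  by (induction k arbitrary: f) (auto intro: continuous_on_subset)

lemma times_cont_diff_on_Suc_imp:
  "times_cont_diff_on (Suc k) f N \<Longrightarrow> times_cont_diff_on k f N"
proof (induction k arbitrary: f)
  case 0
  then show ?case
    by (auto intro!: continuous_at_imp_continuous_on differentiable_imp_continuous_within)
qed auto

text \<open>
  A derivative may be known only on the set in question, and by an explicit formula; this is the form
  in which all closure properties below are proved by induction on the order.
\<close>

lemma times_cont_diff_on_SucI:
  assumes "open N" "\<And>x. x \<in> N \<Longrightarrow> (f has_derivative f' x) (at x)"
    and "\<And>v. times_cont_diff_on k (\<lambda>x. f' x v) N"
  shows "times_cont_diff_on (Suc k) f N"
proof -
  have "times_cont_diff_on k (\<lambda>x. frechet_derivative f (at x) v) N" for v
    using times_cont_diff_on_cong[OF assms(1), of "\<lambda>x. frechet_derivative f (at x) v" "\<lambda>x. f' x v" k]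
      frechet_derivative_at[OF assms(2)] assms(3) by simp
  then show ?thesis using assms(2) by (auto simp: differentiable_def)
qed

lemma times_cont_diff_on_has_derivative:
  "times_cont_diff_on (Suc k) f N \<Longrightarrow> x \<in> N \<Longrightarrow> (f has_derivative frechet_derivative f (at x)) (at x)"
  by (simp add: frechet_derivative_works)

lemma times_cont_diff_on_const: "open N \<Longrightarrow> times_cont_diff_on k (\<lambda>x. c) N"
  by (induction k arbitrary: c) (auto simp: frechet_derivative_const)

lemma times_cont_diff_on_bounded_linear:
  assumes "open N" "bounded_linear L"
  shows "times_cont_diff_on k L N"
proof (cases k)
  case 0
  then show ?thesis using assms(2) by (simp add: linear_continuous_on)
next
  case (Suc j)
  show ?thesis unfolding Suc
    by (rule times_cont_diff_on_SucI[where f' = "\<lambda>_. L", OF assms(1)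
        bounded_linear_imp_has_derivative[OF assms(2)] times_cont_diff_on_const[OF assms(1)]])
qed

lemma times_cont_diff_on_add:
  assumes "open N" "times_cont_diff_on k f N" "times_cont_diff_on k g N"
  shows "times_cont_diff_on k (\<lambda>x. f x + g x) N"
  using assms(2,3)
proof (induction k arbitrary: f g)
  case 0
  then show ?case by (auto intro: continuous_intros)
next
  case (Suc k)
  show ?case
  proof (rule times_cont_diff_on_SucI[OF assms(1)])
    fix x assume "x \<in> N"
    then show "((\<lambda>x. f x + g x) has_derivative
        (\<lambda>v. frechet_derivative f (at x) v + frechet_derivative g (at x) v)) (at x)"
      using Suc.prems by (intro has_derivative_add times_cont_diff_on_has_derivative)
  qed (use Suc in auto)
qed

lemma times_cont_diff_on_bilinear:
  assumes "open N" "bounded_bilinear P" "times_cont_diff_on k f N" "times_cont_diff_on k g N"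
  shows "times_cont_diff_on k (\<lambda>x. P (f x) (g x)) N"
  using assms(3,4)
proof (induction k arbitrary: f g)
  case 0
  then show ?case using bounded_bilinear.continuous_on[OF assms(2)] by auto
next
  case (Suc k)
  show ?case
  proof (rule times_cont_diff_on_SucI[OF assms(1)])
    fix x assume "x \<in> N"
    then show "((\<lambda>x. P (f x) (g x)) has_derivative
        (\<lambda>v. P (f x) (frechet_derivative g (at x) v) + P (frechet_derivative f (at x) v) (g x))) (at x)"
      using Suc.prems by (intro bounded_bilinear.FDERIV[OF assms(2)] times_cont_diff_on_has_derivative)
  next
    show "times_cont_diff_on k (\<lambda>x. P (f x) (frechet_derivative g (at x) v)
        + P (frechet_derivative f (at x) v) (g x)) N" for v
      using Suc.prems times_cont_diff_on_Suc_imp[OF Suc.prems(1)] times_cont_diff_on_Suc_imp[OF Suc.prems(2)]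
      by (intro times_cont_diff_on_add[OF assms(1)] Suc.IH) auto
  qed
qed

lemma times_cont_diff_on_sum:
  assumes "open N" "\<And>i. i \<in> I \<Longrightarrow> times_cont_diff_on k (f i) N"
  shows "times_cont_diff_on k (\<lambda>x. \<Sum>i\<in>I. f i x) N"
  using assms(2)
  by (induction I rule: infinite_finite_induct)
    (auto intro!: times_cont_diff_on_const times_cont_diff_on_add assms(1))

text \<open>
  The chain rule expresses the derivative of a composition through the outer derivative along a
  moving direction. Expanded in a basis it becomes a sum of products of functions to which the
  induction hypothesis and the product rule apply.
\<close>

lemma times_cont_diff_on_compose:
  fixes f :: "'a::euclidean_space \<Rightarrow> 'b::euclidean_space" and g :: "'b \<Rightarrow> 'c::real_normed_vector"
  assumes "open N" "open M" "f ` N \<subseteq> M" "times_cont_diff_on k f N" "times_cont_diff_on k g M"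
  shows "times_cont_diff_on k (\<lambda>x. g (f x)) N"
  using assms(4,5)
proof (induction k arbitrary: g)
  case 0
  then show ?case using assms(3) by (auto intro: continuous_on_compose2)
next
  case (Suc k)
  note fd = times_cont_diff_on_has_derivative[OF Suc.prems(1)]
    and gd = times_cont_diff_on_has_derivative[OF Suc.prems(2)]
  show ?case
  proof (rule times_cont_diff_on_SucI[OF assms(1)])
    fix x assume x: "x \<in> N"
    then have fx: "f x \<in> M" using assms(3) by auto
    have "frechet_derivative g (at (f x)) (frechet_derivative f (at x) v)
        = (\<Sum>b\<in>Basis. (frechet_derivative f (at x) v \<bullet> b) *\<^sub>R frechet_derivative g (at (f x)) b)" for v
    proof -
      interpret linear "frechet_derivative g (at (f x))"
        using gd[OF fx] by (rule has_derivative_linear)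
      show ?thesis
        by (subst euclidean_representation[of "frechet_derivative f (at x) v", symmetric])
          (simp only: sum scaleR)
    qed
    with diff_chain_at[OF fd[OF x] gd[OF fx]]
    show "((\<lambda>x. g (f x)) has_derivative
        (\<lambda>v. \<Sum>b\<in>Basis. (frechet_derivative f (at x) v \<bullet> b) *\<^sub>R frechet_derivative g (at (f x)) b)) (at x)"
      by (simp add: comp_def)
  next
    fix v
    have "times_cont_diff_on k (\<lambda>x. frechet_derivative f (at x) v \<bullet> b) N" for b
      using Suc.prems by (intro times_cont_diff_on_bilinear[OF assms(1) bounded_bilinear_inner]
        times_cont_diff_on_const assms(1)) auto
    moreover have "times_cont_diff_on k (\<lambda>x. frechet_derivative g (at (f x)) b) N" for b
      using Suc.prems by (intro Suc.IH times_cont_diff_on_Suc_imp[OF Suc.prems(1)]) auto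
    ultimately show "times_cont_diff_on k (\<lambda>x. \<Sum>b\<in>Basis.
        (frechet_derivative f (at x) v \<bullet> b) *\<^sub>R frechet_derivative g (at (f x)) b) N"
      by (intro times_cont_diff_on_sum times_cont_diff_on_bilinear[OF assms(1) bounded_bilinear_scaleR] assms(1))
  qed
qed

lemma times_cont_diff_on_inverse:
  "times_cont_diff_on k (inverse :: real \<Rightarrow> real) (- {0})"
proof (induction k)
  case 0
  then show ?case by (auto intro!: continuous_intros)
next
  case (Suc k)
  have o: "open (- {0::real})" by auto
  show ?case
  proof (rule times_cont_diff_on_SucI[where f' = "\<lambda>x v. - (inverse x * v * inverse x)", OF o])
    show "times_cont_diff_on k (\<lambda>x. - (inverse x * v * inverse x)) (- {0})" for v :: real
      using times_cont_diff_on_bilinear[OF o bounded_bilinear_mult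
          times_cont_diff_on_bilinear[OF o bounded_bilinear_mult times_cont_diff_on_const[OF o, of k "-v"] Suc] Suc]
      by (simp add: mult_ac)
  qed (auto intro: has_derivative_inverse')
qed

lemma smooth_onE:
  assumes "smooth_on S f" "x \<in> S"
  obtains N g where "open N" "x \<in> N" "\<And>k. times_cont_diff_on k g N" "\<And>y. y \<in> S \<inter> N \<Longrightarrow> f y = g y"
  using assms unfolding smooth_on_def by metis

lemma smooth_on_open:
  assumes "open S" "\<And>k. times_cont_diff_on k f S"
  shows "smooth_on S f"
  using assms unfolding smooth_on_def by blast

lemma smooth_on_cong:
  assumes "smooth_on S f" "\<And>x. x \<in> S \<Longrightarrow> f x = g x"
  shows "smooth_on S g"
  using assms unfolding smooth_on_def by (metis IntE)

lemma smooth_on_compose: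
  fixes f :: "'a::euclidean_space \<Rightarrow> 'b::euclidean_space" and g :: "'b \<Rightarrow> 'c::real_normed_vector"
  assumes f: "smooth_on S f" and g: "smooth_on T g" and "f ` S \<subseteq> T"
  shows "smooth_on S (\<lambda>x. g (f x))"
  unfolding smooth_on_def
proof
  fix x assume x: "x \<in> S"
  obtain N f' where N: "open N" "x \<in> N" "\<And>k. times_cont_diff_on k f' N" "\<And>y. y \<in> S \<inter> N \<Longrightarrow> f y = f' y"
    using smooth_onE[OF f x] by metis
  have "f x \<in> T" using assms(3) x by auto
  obtain M g' where M: "open M" "f x \<in> M" "\<And>k. times_cont_diff_on k g' M" "\<And>y. y \<in> T \<inter> M \<Longrightarrow> g y = g' y"
    using smooth_onE[OF g \<open>f x \<in> T\<close>] by metis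
  have "continuous_on N f'" using N(3)[of 0] by simp
  then have o: "open (f' -` M \<inter> N)"
    using N(1) M(1) continuous_open_vimage[of M f'] by (metis continuous_on_open_vimage)
  have "times_cont_diff_on k (\<lambda>y. g' (f' y)) (f' -` M \<inter> N)" for k
    by (rule times_cont_diff_on_compose[OF o M(1) _ times_cont_diff_on_subset[OF N(3)] M(3)]) auto
  moreover have "x \<in> f' -` M \<inter> N" "\<forall>y\<in>S \<inter> (f' -` M \<inter> N). g (f y) = g' (f' y)"
    using x N(2,4) M(2,4) assms(3) by (auto simp: image_subset_iff)
  ultimately show "\<exists>N ga. open N \<and> x \<in> N \<and> (\<forall>k. times_cont_diff_on k ga N) \<and> (\<forall>y\<in>S \<inter> N. g (f y) = ga y)"
    using o by blast
qed

lemma smooth_on_bilinear: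
  assumes P: "bounded_bilinear P" and f: "smooth_on S f" and g: "smooth_on S g"
  shows "smooth_on S (\<lambda>x. P (f x) (g x))"
  unfolding smooth_on_def
proof
  fix x assume x: "x \<in> S"
  obtain N f' where N: "open N" "x \<in> N" "\<And>k. times_cont_diff_on k f' N" "\<And>y. y \<in> S \<inter> N \<Longrightarrow> f y = f' y"
    using smooth_onE[OF f x] by metis
  obtain M g' where M: "open M" "x \<in> M" "\<And>k. times_cont_diff_on k g' M" "\<And>y. y \<in> S \<inter> M \<Longrightarrow> g y = g' y"
    using smooth_onE[OF g x] by metis
  have "times_cont_diff_on k (\<lambda>y. P (f' y) (g' y)) (N \<inter> M)" for k
    using N M by (intro times_cont_diff_on_bilinear[OF _ P]) (auto intro: times_cont_diff_on_subset)
  then show "\<exists>N ga. open N \<and> x \<in> N \<and> (\<forall>k. times_cont_diff_on k ga N) \<and> (\<forall>y\<in>S \<inter> N. P (f y) (g y) = ga y)"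
    using N M by (intro exI[of _ "N \<inter> M"] exI[of _ "\<lambda>y. P (f' y) (g' y)"]) auto
qed

lemma smooth_on_bounded_linear: "bounded_linear L \<Longrightarrow> smooth_on UNIV L"
  by (intro smooth_on_open times_cont_diff_on_bounded_linear) auto

lemma smooth_on_linear_compose:
  fixes f :: "'a::euclidean_space \<Rightarrow> 'b::euclidean_space"
  assumes "bounded_linear L" "smooth_on S f"
  shows "smooth_on S (\<lambda>x. L (f x))"
  using smooth_on_compose[OF assms(2) smooth_on_bounded_linear[OF assms(1)]] by simp

lemma smooth_on_const: "smooth_on S (\<lambda>x. c)"
  unfolding smooth_on_def using times_cont_diff_on_const[OF open_UNIV] by blast

lemma smooth_on_id: "smooth_on S (\<lambda>x. x)"
  unfolding smooth_on_def using times_cont_diff_on_bounded_linear[OF open_UNIV bounded_linear_ident] by blast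

lemma smooth_on_add:
  assumes f: "smooth_on S f" and g: "smooth_on S g"
  shows "smooth_on S (\<lambda>x. f x + g x)"
  unfolding smooth_on_def
proof
  fix x assume x: "x \<in> S"
  obtain N f' where N: "open N" "x \<in> N" "\<And>k. times_cont_diff_on k f' N" "\<And>y. y \<in> S \<inter> N \<Longrightarrow> f y = f' y"
    using smooth_onE[OF f x] by metis
  obtain M g' where M: "open M" "x \<in> M" "\<And>k. times_cont_diff_on k g' M" "\<And>y. y \<in> S \<inter> M \<Longrightarrow> g y = g' y"
    using smooth_onE[OF g x] by metis
  have "times_cont_diff_on k (\<lambda>y. f' y + g' y) (N \<inter> M)" for k
    using N M by (intro times_cont_diff_on_add) (auto intro: times_cont_diff_on_subset)
  then show "\<exists>N ga. open N \<and> x \<in> N \<and> (\<forall>k. times_cont_diff_on k ga N) \<and> (\<forall>y\<in>S \<inter> N. f y + g y = ga y)"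
    using N M by (intro exI[of _ "N \<inter> M"] exI[of _ "\<lambda>y. f' y + g' y"]) auto
qed

lemma smooth_on_inverse:
  fixes f :: "'a::euclidean_space \<Rightarrow> real"
  assumes "smooth_on S f" "\<And>x. x \<in> S \<Longrightarrow> f x \<noteq> 0"
  shows "smooth_on S (\<lambda>x. inverse (f x))"
  using assms(2) by (intro smooth_on_compose[OF assms(1) smooth_on_open[OF _ times_cont_diff_on_inverse]]) auto

text \<open>
  All that the topological part of the argument uses of smoothness.
\<close>

lemma smooth_on_imp_C1:
  assumes "open S" "smooth_on S f"
  shows "x \<in> S \<Longrightarrow> (f has_derivative frechet_derivative f (at x)) (at x)"
    and "continuous_on S (\<lambda>x. frechet_derivative f (at x) v)"
proof -
  have *: "(f has_derivative frechet_derivative f (at x)) (at x) \<and>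
      isCont (\<lambda>x. frechet_derivative f (at x) v) x" if x: "x \<in> S" for x
  proof -
    obtain N g where N: "open N" "x \<in> N" "\<And>k. times_cont_diff_on k g N" "\<And>y. y \<in> S \<inter> N \<Longrightarrow> f y = g y"
      using smooth_onE[OF assms(2) x] by metis
    have o: "open (S \<inter> N)" "x \<in> S \<inter> N" using N assms x by auto
    have "times_cont_diff_on (Suc 0) g (S \<inter> N)"
      by (rule times_cont_diff_on_subset[OF N(3)]) auto
    then have C1: "times_cont_diff_on (Suc 0) f (S \<inter> N)"
      by (simp only: times_cont_diff_on_cong[OF o(1) N(4)])
    then have "continuous_on (S \<inter> N) (\<lambda>x. frechet_derivative f (at x) v)" by simp
    then have "isCont (\<lambda>x. frechet_derivative f (at x) v) x"
      using o continuous_on_eq_continuous_at by blast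
    with times_cont_diff_on_has_derivative[OF C1 o(2)] show ?thesis by blast
  qed
  then show "x \<in> S \<Longrightarrow> (f has_derivative frechet_derivative f (at x)) (at x)"
    and "continuous_on S (\<lambda>x. frechet_derivative f (at x) v)"
    by (auto intro: continuous_at_imp_continuous_on)
qed

section \<open>Winding numbers and zeros of continuous functions\<close>

lemma winding_number_exp_path:
  assumes "path q" "\<And>t. t \<in> {0..1} \<Longrightarrow> p t = exp (q t)"
  shows "winding_number p 0 = (pathfinish q - pathstart q) / (2 * of_real pi * \<i>)"
  using winding_number_compose_exp[OF assms(1)] winding_number_cong[of p "exp \<circ> q" 0] assms(2)
  by simp

text \<open>
  Logarithms along the two paths add up.
\<close>

lemma winding_number_mult:
  assumes p: "path p" "0 \<notin> path_image p" and q: "path q" "0 \<notin> path_image q"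
  shows "winding_number (\<lambda>t. p t * q t) 0 = winding_number p 0 + winding_number q 0"
proof -
  obtain a where a: "path a" "pathfinish a - pathstart a = 2 * of_real pi * \<i> * winding_number p 0"
      "\<And>t. t \<in> {0..1} \<Longrightarrow> p t = 0 + exp (a t)"
    using winding_number_as_continuous_log[OF p] by metis
  obtain b where b: "path b" "pathfinish b - pathstart b = 2 * of_real pi * \<i> * winding_number q 0"
      "\<And>t. t \<in> {0..1} \<Longrightarrow> q t = 0 + exp (b t)"
    using winding_number_as_continuous_log[OF q] by metis
  have "winding_number (\<lambda>t. p t * q t) 0
      = (pathfinish (\<lambda>t. a t + b t) - pathstart (\<lambda>t. a t + b t)) / (2 * of_real pi * \<i>)"
    using a(1,3) b(1,3) by (intro winding_number_exp_path) (auto simp: path_def exp_add intro: continuous_intros)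
  also have "\<dots> = ((pathfinish a - pathstart a) + (pathfinish b - pathstart b)) / (2 * of_real pi * \<i>)"
    by (simp add: pathfinish_def pathstart_def)
  also have "\<dots> = winding_number p 0 + winding_number q 0"
    unfolding a(2) b(2) by (simp add: field_simps)
  finally show ?thesis .
qed

lemma winding_number_powi:
  assumes p: "path p" "0 \<notin> path_image p"
  shows "winding_number (\<lambda>t. p t powi k) 0 = of_int k * winding_number p 0"
proof -
  obtain a where a: "path a" "pathfinish a - pathstart a = 2 * of_real pi * \<i> * winding_number p 0"
      "\<And>t. t \<in> {0..1} \<Longrightarrow> p t = 0 + exp (a t)"
    using winding_number_as_continuous_log[OF p] by metis
  have "winding_number (\<lambda>t. p t powi k) 0
      = (pathfinish (\<lambda>t. of_int k * a t) - pathstart (\<lambda>t. of_int k * a t)) / (2 * of_real pi * \<i>)"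
    using a(1,3) by (intro winding_number_exp_path) (auto simp: path_def exp_power_int intro: continuous_intros)
  also have "\<dots> = of_int k * (pathfinish a - pathstart a) / (2 * of_real pi * \<i>)"
    by (simp add: pathfinish_def pathstart_def right_diff_distrib)
  also have "\<dots> = of_int k * winding_number p 0"
    unfolding a(2) by (simp add: field_simps)
  finally show ?thesis .
qed

lemma circlepath_in_sphere:
  assumes "0 \<le> r" "0 \<le> t" "t \<le> 1"
  shows "circlepath a r t \<in> sphere a r"
  using assms by (simp flip: path_image_circlepath_nonneg add: path_image_def)

lemma path_image_comp_circlepath:
  assumes "0 \<le> r" shows "path_image (f \<circ> circlepath a r) = f ` sphere a r"
  using assms by (simp add: path_image_compose)

lemma path_comp_circlepath:
  assumes "0 \<le> r" "continuous_on (sphere a r) f"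
  shows "path (f \<circ> circlepath a r)"
  using assms by (intro path_continuous_image) auto

lemma winding_number_comp_circlepath_mult:
  assumes "0 \<le> r" "continuous_on (sphere a r) f" "continuous_on (sphere a r) g"
    "\<And>z. z \<in> sphere a r \<Longrightarrow> f z \<noteq> 0 \<and> g z \<noteq> 0"
  shows "winding_number ((\<lambda>z. f z * g z) \<circ> circlepath a r) 0
       = winding_number (f \<circ> circlepath a r) 0 + winding_number (g \<circ> circlepath a r) 0"
proof -
  have "0 \<notin> path_image (f \<circ> circlepath a r)" "0 \<notin> path_image (g \<circ> circlepath a r)"
    using assms(1,4) by (force simp: path_image_comp_circlepath)+
  from winding_number_mult[OF path_comp_circlepath[OF assms(1,2)] this(1)
      path_comp_circlepath[OF assms(1,3)] this(2)]
  show ?thesis by (simp add: comp_def)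
qed

lemma winding_number_nonvanishing_on_cball:
  assumes "0 \<le> r" "continuous_on (cball a r) f" "\<And>z. z \<in> cball a r \<Longrightarrow> f z \<noteq> 0"
  shows "winding_number (f \<circ> circlepath a r) 0 = 0"
proof -
  obtain g where g: "continuous_on (cball a r) g" "\<And>z. z \<in> cball a r \<Longrightarrow> f z = exp (g z)"
    using continuous_logarithm_on_contractible[OF assms(2) convex_imp_contractible] assms(3) by (metis convex_cball)
  have sub: "circlepath a r t \<in> cball a r" if "t \<in> {0..1}" for t
    using that assms(1) path_image_circlepath_nonneg[OF assms(1), of a]
    by (force simp: path_image_def)
  have "winding_number (f \<circ> circlepath a r) 0
     = (pathfinish (g \<circ> circlepath a r) - pathstart (g \<circ> circlepath a r)) / (2 * of_real pi * \<i>)"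
    using sub g assms(1)
    by (intro winding_number_exp_path path_continuous_image) (auto intro: continuous_on_subset)
  then show ?thesis by (simp add: pathfinish_compose pathstart_compose)
qed

text \<open>
  A loop in the punctured plane with winding number zero is contractible there, and a contractible
  map on a circle extends over the disc.
\<close>

lemma nonvanishing_extension_to_cball:
  assumes r: "r > 0" and f: "continuous_on (sphere a r) f" "\<And>z. z \<in> sphere a r \<Longrightarrow> f z \<noteq> 0"
    and w: "winding_number (f \<circ> circlepath a r) 0 = 0"
  obtains g where "continuous_on (cball a r) g" "\<And>z. z \<in> cball a r \<Longrightarrow> g z \<noteq> (0::complex)"
    "\<And>z. z \<in> sphere a r \<Longrightarrow> g z = f z"
proof -
  define G where "G = (\<lambda>z. f (a + of_real r * z))"
  have "\<exists>c. homotopic_loops (-{0}) (f \<circ> circlepath a r) (\<lambda>t. c)"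
    using winding_number_homotopic_loops_null_eq[of "f \<circ> circlepath a r" 0] f r w
    by (force simp: path_comp_circlepath path_image_comp_circlepath)
  then obtain c where "homotopic_loops (-{0}) (f \<circ> circlepath a r) (\<lambda>t. c)" ..
  from homotopic_loops_imp_homotopic_circlemaps[OF this]
  have "homotopic_with_canon (\<lambda>h. True) (sphere 0 1) (-{0}) G (\<lambda>t. c)"
  proof (rule homotopic_with_eq)
    fix z :: complex assume "z \<in> topspace (top_of_set (sphere 0 1))"
    then have "z = exp (\<i> * of_real (Arg2pi z))"
      using Arg2pi_eq[of z] by simp
    then show "G z = (f \<circ> circlepath a r \<circ> (\<lambda>z. Arg2pi z / (2 * pi))) z"
      by (simp add: G_def circlepath mult_ac)
  qed auto
  then have "\<exists>c. homotopic_with_canon (\<lambda>h. True) (sphere 0 1) (-{0}) G (\<lambda>t. c)" by blast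
  then obtain g where g: "continuous_on (cball 0 1) g" "g ` cball 0 1 \<subseteq> -{0}" "\<forall>x\<in>sphere 0 1. g x = G x"
    using nullhomotopic_from_sphere_extension[of 0 1 "-{0}" G] by blast
  have im: "(z - a) / of_real r \<in> cball 0 1" if "z \<in> cball a r" for z
    using that r by (simp add: norm_divide dist_norm norm_minus_commute)
  show ?thesis
  proof (rule that[of "\<lambda>z. g ((z - a) / of_real r)"])
    show "continuous_on (cball a r) (\<lambda>z. g ((z - a) / of_real r))"
      using im r by (intro continuous_on_compose2[OF g(1)] continuous_intros) auto
    show "g ((z - a) / of_real r) \<noteq> 0" if "z \<in> cball a r" for z
      using im[OF that] g(2) by blast
    show "g ((z - a) / of_real r) = f z" if "z \<in> sphere a r" for z
      using that r g(3) by (simp add: norm_divide dist_norm norm_minus_commute G_def)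
  qed
qed

text \<open>
  The hypothesis on \<open>\<gamma>\<close> makes it a perturbation of the circle
  \<open>p + a exp (2 pi i t)\<close>, small compared with its distance to \<open>p\<close> and to the boundary of the ball.
  Hence \<open>\<gamma>\<close> is homotopic to that circle, and the circle to any other one about \<open>p\<close>, inside the
  punctured ball, where \<open>f\<close> has no zeros.
\<close>

lemma winding_number_around_punctured_ball:
  assumes cont: "continuous_on (ball p \<delta> - {p}) f"
    and nz: "\<And>z. z \<in> ball p \<delta> - {p} \<Longrightarrow> f z \<noteq> 0"
    and a: "a \<noteq> 0" "cmod a < \<delta>" and \<rho>: "0 < \<rho>" "\<rho> < \<delta>"
    and \<gamma>: "path \<gamma>" "pathfinish \<gamma> = pathstart \<gamma>"
    and near: "\<And>t. t \<in> {0..1} \<Longrightarrow> cmod (\<gamma> t - (p + a * exp (2 * of_real pi * \<i> * of_real t)))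
                  < min (cmod a) (\<delta> - cmod a)"
  shows "winding_number (f \<circ> \<gamma>) 0 = winding_number (f \<circ> circlepath p \<rho>) 0"
proof -
  define e where "e = (\<lambda>t::real. exp (2 * of_real pi * \<i> * of_real t))"
  have ne: "cmod (e t) = 1" for t by (simp add: e_def)
  have e1: "e 1 = e 0" by (simp add: e_def)
  have "homotopic_loops (ball p \<delta> - {p}) \<gamma> (\<lambda>t. p + a * e t)"
  proof (rule homotopic_loops_linear)
    show "path (\<lambda>t. p + a * e t)" unfolding path_def e_def by (intro continuous_intros)
    show "pathfinish (\<lambda>t. p + a * e t) = pathstart (\<lambda>t. p + a * e t)"
      by (simp add: pathfinish_def pathstart_def e1)
    fix t :: real assume t: "t \<in> {0..1}"
    show "closed_segment (\<gamma> t) (p + a * e t) \<subseteq> ball p \<delta> - {p}"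
    proof
      fix x assume "x \<in> closed_segment (\<gamma> t) (p + a * e t)"
      then have "cmod (x - (p + a * e t)) \<le> cmod (\<gamma> t - (p + a * e t))"
        using segment_bound(2)[of x "\<gamma> t" "p + a * e t"] by (simp add: norm_minus_commute)
      with near[OF t] have x: "cmod (x - (p + a * e t)) < cmod a" "cmod (x - (p + a * e t)) < \<delta> - cmod a"
        by (auto simp: e_def)
      have "cmod (x - p) \<le> cmod (x - (p + a * e t)) + cmod (a * e t)"
        by (rule order_trans[OF _ norm_triangle_ineq]) simp
      with x(2) have "cmod (x - p) < \<delta>" by (simp add: norm_mult ne)
      moreover have "x \<noteq> p" using x(1) by (auto simp: norm_mult ne)
      ultimately show "x \<in> ball p \<delta> - {p}" by (simp add: dist_norm norm_minus_commute)
    qed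
  qed (use \<gamma> in auto)
  moreover have "homotopic_loops (ball p \<delta> - {p}) (\<lambda>t. p + a * e t) (circlepath p \<rho>)"
  proof -
    \<comment> \<open>Interpolating the logarithms of the two radii (and phases) keeps the modulus between them.\<close>
    define h where "h = (\<lambda>(s::real, t). p + exp ((1 - of_real s) * Ln a + of_real s * Ln (of_real \<rho>)) * e t)"
    have "continuous_on ({0..1} \<times> {0..1}) h"
      unfolding h_def e_def case_prod_unfold by (intro continuous_intros)
    moreover have "h \<in> ({0..1} \<times> {0..1}) \<rightarrow> ball p \<delta> - {p}"
    proof
      fix x :: "real \<times> real" assume "x \<in> {0..1} \<times> {0..1}"
      then obtain s t where x: "x = (s, t)" and s: "s \<in> {0..1}" by auto
      have "Re ((1 - of_real s) * Ln a + of_real s * Ln (of_real \<rho>)) = (1 - s) * ln (cmod a) + s * ln \<rho>"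
        using a \<rho> by (simp add: Ln_of_real)
      also have "\<dots> < ln \<delta>"
      proof -
        have "ln (cmod a) < ln \<delta>" "ln \<rho> < ln \<delta>" using a \<rho> by auto
        then show ?thesis using s
          by (smt (verit) atLeastAtMost_iff convex_bound_lt)
      qed
      finally have "cmod (exp ((1 - of_real s) * Ln a + of_real s * Ln (of_real \<rho>))) < \<delta>"
        using \<rho> by (metis norm_exp_eq_Re exp_less_mono exp_ln less_trans)
      then have "h x \<in> ball p \<delta>" by (simp add: x h_def dist_norm norm_mult ne)
      moreover have "h x \<noteq> p" using ne[of t] by (auto simp: x h_def)
      ultimately show "h x \<in> ball p \<delta> - {p}" by simp
    qed
    ultimately show ?thesis
      unfolding homotopic_loops using a \<rho>
      by (intro exI[of _ h]) (auto simp: h_def e_def circlepath pathfinish_def pathstart_def mult_ac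
          simp flip: e1)
  qed
  ultimately have "homotopic_loops (ball p \<delta> - {p}) \<gamma> (circlepath p \<rho>)"
    by (rule homotopic_loops_trans)
  then have "homotopic_loops (-{0}) (f \<circ> \<gamma>) (f \<circ> circlepath p \<rho>)"
    using cont nz by (intro homotopic_loops_continuous_image) auto
  then show ?thesis by (rule winding_number_homotopic_loops)
qed

text \<open>
  All small circles are taken at once because the radius below which the winding number is constant
  depends on \<open>f\<close> and \<open>p\<close>.
\<close>

definition zero_index :: "(complex \<Rightarrow> complex) \<Rightarrow> complex \<Rightarrow> int" where
  "zero_index f p = (THE k. \<forall>\<^sub>F \<epsilon> in at_right 0. winding_number (f \<circ> circlepath p \<epsilon>) 0 = of_int k)"

lemma winding_number_eq_zero_index:
  assumes cont: "continuous_on (ball p \<delta> - {p}) f"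
    and nz: "\<And>z. z \<in> ball p \<delta> - {p} \<Longrightarrow> f z \<noteq> 0"
    and \<rho>: "0 < \<rho>" "\<rho> < \<delta>"
  shows "winding_number (f \<circ> circlepath p \<rho>) 0 = of_int (zero_index f p)"
proof -
  have sub: "sphere p \<epsilon> \<subseteq> ball p \<delta> - {p}" if "0 < \<epsilon>" "\<epsilon> < \<delta>" for \<epsilon>
    using that by auto
  have "path (f \<circ> circlepath p \<rho>)" "0 \<notin> path_image (f \<circ> circlepath p \<rho>)"
    using \<rho> nz sub[OF \<rho>] continuous_on_subset[OF cont sub[OF \<rho>]]
    by (auto simp: path_comp_circlepath path_image_comp_circlepath)
  then have "winding_number (f \<circ> circlepath p \<rho>) 0 \<in> \<int>"
    by (intro integer_winding_number) (auto simp: pathfinish_compose pathstart_compose)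
  then obtain k :: int where k: "winding_number (f \<circ> circlepath p \<rho>) 0 = of_int k"
    by (auto simp: Ints_def)
  have "winding_number (f \<circ> circlepath p \<epsilon>) 0 = winding_number (f \<circ> circlepath p \<rho>) 0"
    if "0 < \<epsilon>" "\<epsilon> < \<delta>" for \<epsilon>
    using that \<rho> by (intro winding_number_around_punctured_ball[OF cont nz, where a = "of_real \<epsilon>"])
      (auto simp flip: circlepath simp add: circlepath[symmetric, unfolded fun_eq_iff, rule_format])
  then have ev: "\<forall>\<^sub>F \<epsilon> in at_right 0. winding_number (f \<circ> circlepath p \<epsilon>) 0 = of_int k"
    unfolding eventually_at_right_field using \<rho> k by (intro exI[of _ \<delta>]) auto
  have "zero_index f p = k"
    unfolding zero_index_def
  proof (rule the_equality)
    show "\<forall>\<^sub>F \<epsilon> in at_right 0. winding_number (f \<circ> circlepath p \<epsilon>) 0 = of_int k" by (fact ev)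
    fix l :: int
    assume "\<forall>\<^sub>F \<epsilon> in at_right 0. winding_number (f \<circ> circlepath p \<epsilon>) 0 = of_int l"
    with ev have "\<forall>\<^sub>F \<epsilon> in at_right (0::real). l = k"
      by eventually_elim (metis of_int_eq_iff)
    then show "l = k" by simp
  qed
  with k show ?thesis by simp
qed

lemma zero_index_nonzero:
  assumes "continuous_on (ball p \<delta>) f" "\<delta> > 0" "f p \<noteq> 0"
  shows "zero_index f p = 0"
proof -
  have "isCont f p" using assms continuous_on_interior by force
  then have "\<forall>\<^sub>F z in nhds p. f z \<noteq> 0"
    using assms(3) by (intro tendsto_imp_eventually_ne)
      (auto simp: continuous_at_imp_continuous_at_within tendsto_nhds_iff isCont_def)
  then obtain e where e: "e > 0" "\<And>z. dist z p < e \<Longrightarrow> f z \<noteq> 0"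
    by (auto simp: eventually_nhds_metric)
  define d where "d = min e \<delta>"
  have d: "d > 0" "d \<le> e" "d \<le> \<delta>" using e assms by (auto simp: d_def)
  have "winding_number (f \<circ> circlepath p (d/2)) 0 = of_int (zero_index f p)"
    using d e assms(1) by (intro winding_number_eq_zero_index[of p d])
      (auto simp: dist_commute intro: continuous_on_subset)
  moreover have "winding_number (f \<circ> circlepath p (d/2)) 0 = 0"
    using d e assms(1) by (intro winding_number_nonvanishing_on_cball continuous_on_subset[OF assms(1)])
      (auto simp: dist_commute)
  ultimately show ?thesis by simp
qed

lemma zero_index_mult_nonvanishing:
  assumes f: "continuous_on (ball p \<delta> - {p}) f" "\<And>z. z \<in> ball p \<delta> - {p} \<Longrightarrow> f z \<noteq> 0"
    and g: "continuous_on (ball p \<delta>) g" "\<And>z. z \<in> ball p \<delta> \<Longrightarrow> g z \<noteq> 0"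
    and h: "\<And>z. z \<in> ball p \<delta> - {p} \<Longrightarrow> h z = f z * g z" and "\<delta> > 0"
  shows "zero_index h p = zero_index f p"
proof -
  define r where "r = \<delta> / 2"
  have r: "0 < r" "r < \<delta>" using \<open>\<delta> > 0\<close> by (auto simp: r_def)
  have sub: "sphere p r \<subseteq> ball p \<delta> - {p}" "cball p r \<subseteq> ball p \<delta>" using r by auto
  have "continuous_on (ball p \<delta> - {p}) (\<lambda>z. f z * g z)"
    using f(1) g(1) by (intro continuous_on_mult) (auto intro: continuous_on_subset)
  then have "continuous_on (ball p \<delta> - {p}) h"
    by (rule continuous_on_eq) (use h in simp)
  then have "of_int (zero_index h p) = winding_number (h \<circ> circlepath p r) 0"
    using f(2) g(2) h r by (intro winding_number_eq_zero_index[symmetric, of p \<delta>]) auto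
  also have "\<dots> = winding_number ((\<lambda>z. f z * g z) \<circ> circlepath p r) 0"
  proof (rule winding_number_cong)
    fix t :: real assume "0 \<le> t" "t \<le> 1"
    then have "circlepath p r t \<in> sphere p r"
      using r by (intro circlepath_in_sphere) auto
    then show "(h \<circ> circlepath p r) t = ((\<lambda>z. f z * g z) \<circ> circlepath p r) t"
      using h[of "circlepath p r t"] r by (cases "circlepath p r t = p") auto
  qed
  also have "\<dots> = winding_number (f \<circ> circlepath p r) 0 + winding_number (g \<circ> circlepath p r) 0"
    using r sub f g by (intro winding_number_comp_circlepath_mult)
      (blast intro: continuous_on_subset less_imp_le)+
  also have "winding_number (f \<circ> circlepath p r) 0 = of_int (zero_index f p)"
    using r by (intro winding_number_eq_zero_index[OF f])
  also have "winding_number (g \<circ> circlepath p r) 0 = 0"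
    using r sub g by (intro winding_number_nonvanishing_on_cball continuous_on_subset[OF g(1)]) auto
  finally show ?thesis by simp
qed

text \<open>
  The product of \<open>f\<close> and its conjugate is positive, so its winding number vanishes.
\<close>

lemma zero_index_cnj:
  assumes f: "continuous_on (ball p \<delta> - {p}) f" "\<And>z. z \<in> ball p \<delta> - {p} \<Longrightarrow> f z \<noteq> 0" and "\<delta> > 0"
  shows "zero_index (\<lambda>z. cnj (f z)) p = - zero_index f p"
proof -
  define r where "r = \<delta> / 2"
  have r: "0 < r" "r < \<delta>" using \<open>\<delta> > 0\<close> by (auto simp: r_def)
  have sub: "sphere p r \<subseteq> ball p \<delta> - {p}" using r by auto
  have fs: "continuous_on (sphere p r) f" "\<And>z. z \<in> sphere p r \<Longrightarrow> f z \<noteq> 0"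
    using f sub by (blast intro: continuous_on_subset)+
  have cf: "continuous_on (sphere p r) (\<lambda>z. cnj (f z))" by (intro continuous_intros fs)
  have "winding_number ((\<lambda>z. f z * cnj (f z)) \<circ> circlepath p r) 0 = 0"
  proof (rule winding_number_zero_outside[where s = "{z. Re z > 0}"])
    show "path ((\<lambda>z. f z * cnj (f z)) \<circ> circlepath p r)"
      using r by (intro path_comp_circlepath continuous_intros fs) auto
    show "convex {z. Re z > 0}" by (rule convex_halfspace_Re_gt)
    have "Re (f z * cnj (f z)) > 0" if "z \<in> sphere p r" for z
      using fs(2)[OF that] unfolding complex_norm_square[symmetric] by simp
    then show "path_image ((\<lambda>z. f z * cnj (f z)) \<circ> circlepath p r) \<subseteq> {z. Re z > 0}"
      using r by (subst path_image_comp_circlepath) auto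
  qed (auto simp: pathfinish_compose pathstart_compose)
  moreover have "winding_number ((\<lambda>z. f z * cnj (f z)) \<circ> circlepath p r) 0
      = winding_number (f \<circ> circlepath p r) 0 + winding_number ((\<lambda>z. cnj (f z)) \<circ> circlepath p r) 0"
    using r fs cf by (intro winding_number_comp_circlepath_mult) auto
  moreover have "winding_number (f \<circ> circlepath p r) 0 = of_int (zero_index f p)"
    using r by (intro winding_number_eq_zero_index[OF f])
  moreover have "winding_number ((\<lambda>z. cnj (f z)) \<circ> circlepath p r) 0 = of_int (zero_index (\<lambda>z. cnj (f z)) p)"
    using r f by (intro winding_number_eq_zero_index[of p \<delta>] continuous_intros) auto
  ultimately have "of_int (zero_index f p + zero_index (\<lambda>z. cnj (f z)) p) = (0::complex)" by simp
  then have "zero_index f p + zero_index (\<lambda>z. cnj (f z)) p = 0" by (simp only: of_int_eq_0_iff)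
  then show ?thesis by simp
qed

text \<open>
  A local change of variable that preserves the orientation does not alter the index. Its
  derivative \<open>a h + b cnj h\<close> has positive determinant exactly when \<open>\<bar>b\<bar> < \<bar>a\<bar>\<close>, so that the image of a
  small circle stays closer to the circle \<open>a h\<close> than the latter is to its centre.
\<close>

lemma winding_number_local_diffeomorphism:
  assumes \<xi>: "(\<xi> has_derivative (\<lambda>h. a * h + b * cnj h)) (at z)" and ab: "cmod b < cmod a"
    and cont: "open N" "z \<in> N" "continuous_on N \<xi>"
    and f: "continuous_on (ball (\<xi> z) \<delta> - {\<xi> z}) f" "\<And>w. w \<in> ball (\<xi> z) \<delta> - {\<xi> z} \<Longrightarrow> f w \<noteq> 0" "\<delta> > 0"
  shows "\<forall>\<^sub>F \<epsilon> in at_right 0. winding_number ((\<lambda>w. f (\<xi> w)) \<circ> circlepath z \<epsilon>) 0 = of_int (zero_index f (\<xi> z))"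
proof -
  \<comment> \<open>Half of the gap between the moduli absorbs the error of the linear approximation.\<close>
  define c where "c = (cmod a - cmod b) / 2"
  have c: "c > 0" using ab by (simp add: c_def)
  have a: "cmod a > 0" using ab norm_ge_zero[of b] by linarith
  obtain d where d: "d > 0"
    "\<And>w. cmod (w - z) < d \<Longrightarrow> cmod (\<xi> w - \<xi> z - (a * (w - z) + b * cnj (w - z))) \<le> c * cmod (w - z)"
    using \<xi> c unfolding has_derivative_at_alt by blast
  obtain e where e: "e > 0" "ball z e \<subseteq> N" using cont by (meson open_contains_ball)
  \<comment> \<open>The last bound keeps the image of the circle inside the ball of radius \<open>\<delta>\<close>.\<close>
  define m where "m = min (min d e) (\<delta> / (2 * cmod a))"
  have m: "m > 0" using d e a f(3) by (simp add: m_def)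
  have "winding_number ((\<lambda>w. f (\<xi> w)) \<circ> circlepath z \<epsilon>) 0 = of_int (zero_index f (\<xi> z))"
    if \<epsilon>: "0 < \<epsilon>" "\<epsilon> < m" for \<epsilon>
  proof -
    have \<epsilon>': "\<epsilon> < d" "\<epsilon> < e" "2 * (cmod a * \<epsilon>) < \<delta>"
      using \<epsilon> a by (auto simp: m_def field_simps)
    have "winding_number (f \<circ> (\<xi> \<circ> circlepath z \<epsilon>)) 0 = winding_number (f \<circ> circlepath (\<xi> z) (\<delta> / 2)) 0"
    proof (rule winding_number_around_punctured_ball[OF f(1,2), where a = "a * of_real \<epsilon>"])
      show "a * of_real \<epsilon> \<noteq> 0" "cmod (a * of_real \<epsilon>) < \<delta>"
        using a \<epsilon> \<epsilon>' f(3) by (auto simp: norm_mult)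
      have "sphere z \<epsilon> \<subseteq> N" using e \<epsilon>' by (auto simp: subset_iff)
      then show "path (\<xi> \<circ> circlepath z \<epsilon>)"
        using \<epsilon> by (intro path_comp_circlepath continuous_on_subset[OF cont(3)]) auto
      show "pathfinish (\<xi> \<circ> circlepath z \<epsilon>) = pathstart (\<xi> \<circ> circlepath z \<epsilon>)"
        by (simp add: pathfinish_compose pathstart_compose)
      fix t :: real
      define h where "h = of_real \<epsilon> * exp (2 * of_real pi * \<i> * of_real t)"
      have h: "circlepath z \<epsilon> t = z + h" "cmod h = \<epsilon>"
        using \<epsilon> by (auto simp: circlepath h_def norm_mult)
      have "cmod (\<xi> (z + h) - \<xi> z - (a * h + b * cnj h)) \<le> c * \<epsilon>"
        using d(2)[of "z + h"] h \<epsilon>' by simp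
      moreover have "cmod (\<xi> (z + h) - (\<xi> z + a * h))
          \<le> cmod (\<xi> (z + h) - \<xi> z - (a * h + b * cnj h)) + cmod (b * cnj h)"
        by (rule order_trans[OF _ norm_triangle_ineq]) (simp add: algebra_simps)
      ultimately have "cmod (\<xi> (z + h) - (\<xi> z + a * h)) \<le> c * \<epsilon> + cmod b * \<epsilon>"
        by (simp add: norm_mult h)
      also have "\<dots> = (c + cmod b) * \<epsilon>" by (simp add: algebra_simps)
      also have "\<dots> < cmod a * \<epsilon>"
        using ab \<epsilon> by (intro mult_strict_right_mono) (auto simp: c_def field_simps)
      finally have "cmod (\<xi> (z + h) - (\<xi> z + a * h)) < cmod a * \<epsilon>" .
      then show "cmod ((\<xi> \<circ> circlepath z \<epsilon>) t - (\<xi> z + a * of_real \<epsilon> * exp (2 * of_real pi * \<i> * of_real t)))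
          < min (cmod (a * of_real \<epsilon>)) (\<delta> - cmod (a * of_real \<epsilon>))"
        using \<epsilon> \<epsilon>' by (simp add: h norm_mult) (simp add: h_def mult_ac)
    qed (use f(3) in auto)
    also have "\<dots> = of_int (zero_index f (\<xi> z))"
      using f(3) by (intro winding_number_eq_zero_index[OF f(1,2)]) auto
    finally show ?thesis by (simp add: comp_def)
  qed
  with m show ?thesis unfolding eventually_at_right_field by blast
qed

lemma winding_number_powi_circlepath:
  assumes "a \<in> ball c r"
  shows "winding_number ((\<lambda>z. (z - a) powi k) \<circ> circlepath c r) 0 = of_int k"
proof -
  have "norm (a - c) < r" using assms by (simp add: dist_norm norm_minus_commute)
  then have r: "0 \<le> r" using norm_ge_zero[of "a - c"] by linarith
  have "winding_number (\<lambda>t. (circlepath c r t - a) powi k) 0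
      = of_int k * winding_number (\<lambda>t. circlepath c r t - a) 0"
  proof (rule winding_number_powi)
    show "path (\<lambda>t. circlepath c r t - a)"
      unfolding path_def circlepath by (intro continuous_intros)
    have "a \<notin> path_image (circlepath c r)" using assms r by auto
    then show "0 \<notin> path_image (\<lambda>t. circlepath c r t - a)"
      by (auto simp: path_image_def)
  qed
  also have "winding_number (\<lambda>t. circlepath c r t - a) 0 = 1"
    using winding_number_circlepath[OF \<open>norm (a - c) < r\<close>] by (subst (asm) winding_number_offset)
  finally show ?thesis by (simp add: comp_def)
qed

text \<open>
  The argument principle for functions that are merely continuous. A zero \<open>a\<close> of index \<open>n\<close> is
  removed by dividing by \<open>(z - a)\<^sup>n\<close> and filling in a small disc about \<open>a\<close>, which is possible since the
  quotient has winding number zero around it; on the outer circle the division costs exactly \<open>n\<close>.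
\<close>

lemma winding_number_eq_sum_zero_index:
  assumes "finite Z" "Z \<subseteq> ball c R" "R > 0"
    and "continuous_on (cball c R - Z) f" "\<And>z. z \<in> cball c R - Z \<Longrightarrow> f z \<noteq> 0"
  shows "winding_number (f \<circ> circlepath c R) 0 = of_int (\<Sum>a\<in>Z. zero_index f a)"
  using assms(1,2,4,5)
proof (induction Z arbitrary: f rule: finite_induct)
  case empty
  then show ?case using \<open>R > 0\<close> winding_number_nonvanishing_on_cball[of R c f] by (simp add: comp_def)
next
  case (insert a Z)
  note IH = insert.IH and Z = insert.prems(1) and cont = insert.prems(2) and nz = insert.prems(3)
  have "open (ball c R - Z)" "a \<in> ball c R - Z"
    using insert.hyps Z by (auto simp: open_Diff finite_imp_closed)
  then obtain \<delta> where \<delta>: "\<delta> > 0" "ball a \<delta> \<subseteq> ball c R - Z"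
    by (meson open_contains_ball)
  define \<rho> where "\<rho> = \<delta> / 2"
  have \<rho>: "0 < \<rho>" "\<rho> < \<delta>" using \<delta> by (auto simp: \<rho>_def)
  have sub: "cball a \<rho> \<subseteq> ball c R - Z" using \<delta> \<rho> by (force simp: subset_iff)
  have "ball a \<delta> - {a} \<subseteq> cball c R - insert a Z" using \<delta> by auto
  then have wf: "winding_number (f \<circ> circlepath a \<rho>) 0 = of_int (zero_index f a)"
    using \<rho> nz by (intro winding_number_eq_zero_index[of a \<delta>] continuous_on_subset[OF cont]) auto
  define n where "n = zero_index f a"
  define m where "m = (\<lambda>z. (z - a) powi (- n))"
  have m: "continuous_on (- {a}) m" "\<And>z. z \<noteq> a \<Longrightarrow> m z \<noteq> 0"
    unfolding m_def by (auto intro!: continuous_intros)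
  have gcont: "continuous_on (cball c R - insert a Z) (\<lambda>z. f z * m z)"
    using m(1) by (intro continuous_on_mult cont) (auto intro: continuous_on_subset)
  have s1: "sphere a \<rho> \<subseteq> cball c R - insert a Z" using sub \<rho> by auto
  \<comment> \<open>Dividing by \<open>(z - a)\<^sup>n\<close> cancels the winding around \<open>a\<close>, so that the disc can be filled in.\<close>
  have "winding_number ((\<lambda>z. f z * m z) \<circ> circlepath a \<rho>) 0
      = winding_number (f \<circ> circlepath a \<rho>) 0 + winding_number (m \<circ> circlepath a \<rho>) 0"
    using \<rho> s1 m nz by (intro winding_number_comp_circlepath_mult continuous_on_subset[OF cont]
      continuous_on_subset[OF m(1)]) auto
  also have "\<dots> = 0"
    using winding_number_powi_circlepath[of a a \<rho> "-n"] \<rho> wf unfolding m_def n_def by simp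
  finally have "winding_number ((\<lambda>z. f z * m z) \<circ> circlepath a \<rho>) 0 = 0" .
  then obtain e where e: "continuous_on (cball a \<rho>) e" "\<And>z. z \<in> cball a \<rho> \<Longrightarrow> e z \<noteq> 0"
      "\<And>z. z \<in> sphere a \<rho> \<Longrightarrow> e z = f z * m z"
    using nonvanishing_extension_to_cball[of \<rho> a "\<lambda>z. f z * m z"] \<rho> s1 m(2) nz
      continuous_on_subset[OF gcont s1] by (metis (no_types, lifting) DiffD2 insertI1 mult_eq_0_iff subsetD)
  define h where "h = (\<lambda>z. if z \<in> cball a \<rho> then e z else f z * m z)"
  have "continuous_on (cball a \<rho> \<union> (cball c R - Z - ball a \<rho>)) h"
    unfolding h_def
  proof (rule continuous_on_cases_local)
    show "closedin (top_of_set (cball a \<rho> \<union> (cball c R - Z - ball a \<rho>))) (cball a \<rho>)"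
      by (auto intro: closed_subset)
    have "cball c R - Z - ball a \<rho> = (cball a \<rho> \<union> (cball c R - Z - ball a \<rho>)) \<inter> (- ball a \<rho>  \<inter> cball c R)"
      using sub by auto
    then show "closedin (top_of_set (cball a \<rho> \<union> (cball c R - Z - ball a \<rho>))) (cball c R - Z - ball a \<rho>)"
      by (metis closedin_closed closed_Int closed_cball open_ball closed_Compl)
    show "continuous_on (cball c R - Z - ball a \<rho>) (\<lambda>z. f z * m z)"
      using \<rho> by (intro continuous_on_subset[OF gcont]) auto
    show "e z = f z * m z"
      if "z \<in> cball a \<rho> \<and> z \<notin> cball a \<rho> \<or> z \<in> cball c R - Z - ball a \<rho> \<and> z \<in> cball a \<rho>" for z
      using that e(3)[of z] by auto
  qed (rule e)
  moreover have "cball a \<rho> \<union> (cball c R - Z - ball a \<rho>) = cball c R - Z" using sub by auto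
  ultimately have hcont: "continuous_on (cball c R - Z) h" by simp
  have hnz: "h z \<noteq> 0" if "z \<in> cball c R - Z" for z
    using that e(2) nz[of z] m(2)[of z] \<rho> by (cases "z = a") (auto simp: h_def)
  have "winding_number (h \<circ> circlepath c R) 0 = of_int (\<Sum>b\<in>Z. zero_index h b)"
    using Z by (intro IH hcont hnz) auto
  also have "(\<Sum>b\<in>Z. zero_index h b) = (\<Sum>b\<in>Z. zero_index f b)"
  proof (rule sum.cong[OF refl])
    fix b assume b: "b \<in> Z"
    have "open (ball c R - cball a \<rho> - (Z - {b}))" "b \<in> ball c R - cball a \<rho> - (Z - {b})"
      using insert.hyps Z b sub by (auto intro!: open_Diff finite_imp_closed)
    then obtain d where d: "d > 0" "ball b d \<subseteq> ball c R - cball a \<rho> - (Z - {b})"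
      by (meson open_contains_ball)
    have sub: "ball b d - {b} \<subseteq> cball c R - insert a Z" "ball b d \<subseteq> -{a}" using d \<rho> by auto
    show "zero_index h b = zero_index f b"
    proof (rule zero_index_mult_nonvanishing[where g = m])
      show "f z \<noteq> 0" if "z \<in> ball b d - {b}" for z using nz sub(1) that by blast
      show "m z \<noteq> 0" if "z \<in> ball b d" for z using m(2) sub(2) that by blast
      show "h z = f z * m z" if "z \<in> ball b d - {b}" for z using d(2) that by (auto simp: h_def)
    qed (use d sub in \<open>auto intro: continuous_on_subset[OF cont] continuous_on_subset[OF m(1)]\<close>)
  qed
  finally have "winding_number (h \<circ> circlepath c R) 0 = of_int (\<Sum>b\<in>Z. zero_index f b)" .
  moreover have "winding_number (h \<circ> circlepath c R) 0 = winding_number ((\<lambda>z. f z * m z) \<circ> circlepath c R) 0"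
  proof (rule winding_number_cong)
    fix t :: real assume "0 \<le> t" "t \<le> 1"
    then have "circlepath c R t \<in> sphere c R"
      using \<open>R > 0\<close> by (intro circlepath_in_sphere) auto
    then show "(h \<circ> circlepath c R) t = ((\<lambda>z. f z * m z) \<circ> circlepath c R) t"
      using sub by (auto simp: h_def)
  qed
  moreover have "\<dots> = winding_number (f \<circ> circlepath c R) 0 + winding_number (m \<circ> circlepath c R) 0"
  proof (rule winding_number_comp_circlepath_mult)
    have sub: "sphere c R \<subseteq> cball c R - insert a Z" "sphere c R \<subseteq> - {a}" using Z by auto
    then show "continuous_on (sphere c R) f" "continuous_on (sphere c R) m"
      by (auto intro: continuous_on_subset[OF cont] continuous_on_subset[OF m(1)])
    show "f z \<noteq> 0 \<and> m z \<noteq> 0" if "z \<in> sphere c R" for z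
      using sub that nz m(2) by blast
  qed (use \<open>R > 0\<close> in simp)
  moreover have "winding_number (m \<circ> circlepath c R) 0 = - of_int n"
    using winding_number_powi_circlepath[of a c R "-n"] Z unfolding m_def by simp
  ultimately show ?case
    using insert.hyps by (simp add: n_def algebra_simps comp_def)
qed

section \<open>Stereographic coordinates of a globally convex congruence\<close>

lemma half_turn_involution [simp]: "half_turn (half_turn x) = x"
  by (simp add: half_turn_def vec_eq_iff forall_3)

lemma linear_half_turn: "linear half_turn"
  by (rule linearI) (simp_all add: half_turn_def vec_eq_iff forall_3)

lemma norm_half_turn [simp]: "norm (half_turn x) = norm x"
  by (simp add: norm_eq_sqrt_inner half_turn_def inner_vec_def sum_3)

lemma inner_half_turn [simp]: "half_turn x \<bullet> half_turn y = x \<bullet> y"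
  by (simp add: half_turn_def inner_vec_def sum_3)

lemma inner_half_turn_left: "half_turn x \<bullet> y = x \<bullet> half_turn y"
  using inner_half_turn[of x "half_turn y"] by simp

abbreviation half_turn_line :: "line \<Rightarrow> line" where
  "half_turn_line \<equiv> map_prod half_turn half_turn"

lemma half_turn_line_involution [simp]: "half_turn_line (half_turn_line \<gamma>) = \<gamma>"
  by (cases \<gamma>) simp

lemma globally_convex_half_turn:
  assumes "globally_convex \<Sigma>"
  shows "globally_convex (half_turn_line ` \<Sigma>)"
proof -
  obtain s where s: "smooth_on (sphere 0 1) s"
      "\<And>W. W \<in> sphere 0 1 \<Longrightarrow> s W \<in> oriented_lines \<and> snd (s W) = W" "\<Sigma> = s ` sphere 0 1"
    using assms unfolding globally_convex_def by blast
  have H: "bounded_linear half_turn"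
    using linear_half_turn by (rule linear_conv_bounded_linear[THEN iffD1])
  have L: "bounded_linear half_turn_line"
    unfolding linear_conv_bounded_linear[symmetric]
    by (rule linearI) (auto simp: map_prod_def case_prod_unfold linear_add[OF linear_half_turn] linear_scale[OF linear_half_turn])
  have surj: "half_turn ` sphere 0 1 = sphere (0::real^3) 1"
    by (auto intro!: image_eqI[of _ half_turn "half_turn _"])
  show ?thesis unfolding globally_convex_def
  proof (intro exI[of _ "\<lambda>W. half_turn_line (s (half_turn W))"] conjI ballI)
    show "smooth_on (sphere 0 1) (\<lambda>W. half_turn_line (s (half_turn W)))"
      by (rule smooth_on_linear_compose[OF L], rule smooth_on_compose[OF _ s(1)],
          rule smooth_on_linear_compose[OF H smooth_on_id]) auto
    show "half_turn_line ` \<Sigma> = (\<lambda>W. half_turn_line (s (half_turn W))) ` sphere 0 1"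
      unfolding s(3) by (subst (1) surj[symmetric]) (simp add: image_image)
    fix W :: "real^3" assume "W \<in> sphere 0 1"
    then show "half_turn_line (s (half_turn W)) \<in> oriented_lines"
        "snd (half_turn_line (s (half_turn W))) = W"
      using s(2)[of "half_turn W"] by (auto simp: oriented_lines_def inner_half_turn_left)
  qed
qed

lemma one_plus_mult_cnj_neq_0: "1 + \<xi> * cnj \<xi> \<noteq> 0"
  unfolding one_plus_mult_cnj of_real_eq_0_iff by (rule one_plus_squares_neq_0)

text \<open>
  The inverse of \<open>line_point \<xi> F 0\<close> in \<open>F\<close>: the horizontal and vertical coordinates \<open>z\<close> and \<open>h\<close> of the
  point of the line closest to the origin satisfy \<open>z - \<xi> h = 2 F / (1 + \<xi> cnj \<xi>)\<close>.
\<close>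

definition fibre_coordinate :: "complex \<Rightarrow> real^3 \<Rightarrow> complex" where
  "fibre_coordinate \<xi> U =
     ((1 + (Re \<xi>)\<^sup>2 + (Im \<xi>)\<^sup>2) / 2) *\<^sub>R (Complex (U $ 1) (U $ 2) - \<xi> * of_real (U $ 3))"

lemma line_direction_nth:
  "line_direction \<xi> $ 1 = 2 * Re \<xi> / (1 + (Re \<xi>)\<^sup>2 + (Im \<xi>)\<^sup>2)"
  "line_direction \<xi> $ 2 = 2 * Im \<xi> / (1 + (Re \<xi>)\<^sup>2 + (Im \<xi>)\<^sup>2)"
  "line_direction \<xi> $ 3 = (1 - (Re \<xi>)\<^sup>2 - (Im \<xi>)\<^sup>2) / (1 + (Re \<xi>)\<^sup>2 + (Im \<xi>)\<^sup>2)"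
  unfolding line_direction_def Let_def one_plus_mult_cnj
  by (simp_all add: power2_eq_square)

lemma line_point_0_nth:
  fixes \<xi> F :: complex
  defines "d \<equiv> 1 + (Re \<xi>)\<^sup>2 + (Im \<xi>)\<^sup>2"
  shows "line_point \<xi> F 0 $ 1 = 2 * (Re F - (Re F * ((Re \<xi>)\<^sup>2 - (Im \<xi>)\<^sup>2) + Im F * (2 * Re \<xi> * Im \<xi>))) / d\<^sup>2"
    and "line_point \<xi> F 0 $ 2 = 2 * (Im F - (Re F * (2 * Re \<xi> * Im \<xi>) - Im F * ((Re \<xi>)\<^sup>2 - (Im \<xi>)\<^sup>2))) / d\<^sup>2"
    and "line_point \<xi> F 0 $ 3 = - 4 * (Re F * Re \<xi> + Im F * Im \<xi>) / d\<^sup>2"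
proof -
  have d: "(1 + \<xi> * cnj \<xi>)\<^sup>2 = of_real (d\<^sup>2)" by (simp add: d_def one_plus_mult_cnj)
  show "line_point \<xi> F 0 $ 1 = 2 * (Re F - (Re F * ((Re \<xi>)\<^sup>2 - (Im \<xi>)\<^sup>2) + Im F * (2 * Re \<xi> * Im \<xi>))) / d\<^sup>2"
    "line_point \<xi> F 0 $ 2 = 2 * (Im F - (Re F * (2 * Re \<xi> * Im \<xi>) - Im F * ((Re \<xi>)\<^sup>2 - (Im \<xi>)\<^sup>2))) / d\<^sup>2"
    "line_point \<xi> F 0 $ 3 = - 4 * (Re F * Re \<xi> + Im F * Im \<xi>) / d\<^sup>2"
    unfolding line_point_def Let_def d
    by (simp_all add: power2_eq_square algebra_simps)
qed

lemma line_direction_inj: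
  assumes "line_direction \<xi> = line_direction \<eta>" shows "\<xi> = \<eta>"
proof -
  have "1 + line_direction z $ 3 = 2 / (1 + (Re z)\<^sup>2 + (Im z)\<^sup>2)" for z
    unfolding line_direction_nth using one_plus_squares_neq_0[of "Re z" "Im z"] by (simp add: field_simps)
  then have d: "2 / (1 + (Re \<xi>)\<^sup>2 + (Im \<xi>)\<^sup>2) = 2 / (1 + (Re \<eta>)\<^sup>2 + (Im \<eta>)\<^sup>2)"
    using assms by metis
  have "2 / (1 + (Re \<xi>)\<^sup>2 + (Im \<xi>)\<^sup>2) \<noteq> 0"
    using one_plus_squares_neq_0[of "Re \<xi>" "Im \<xi>"] by simp
  moreover have "2 / (1 + (Re \<xi>)\<^sup>2 + (Im \<xi>)\<^sup>2) * Re \<xi> = 2 / (1 + (Re \<eta>)\<^sup>2 + (Im \<eta>)\<^sup>2) * Re \<eta>"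
      "2 / (1 + (Re \<xi>)\<^sup>2 + (Im \<xi>)\<^sup>2) * Im \<xi> = 2 / (1 + (Re \<eta>)\<^sup>2 + (Im \<eta>)\<^sup>2) * Im \<eta>"
    using line_direction_nth[of \<xi>] line_direction_nth[of \<eta>] unfolding assms by simp_all
  ultimately have "Re \<xi> = Re \<eta>" "Im \<xi> = Im \<eta>"
    unfolding d by (metis mult_left_cancel)+
  then show ?thesis by (simp add: complex_eq_iff)
qed

lemma line_direction_neq_south: "line_direction \<xi> \<noteq> south"
proof
  assume "line_direction \<xi> = south"
  then have "line_direction \<xi> $ 3 = -1" by (simp add: south_def)
  then show False
    using one_plus_squares_neq_0[of "Re \<xi>" "Im \<xi>"] unfolding line_direction_nth by (simp add: field_simps)
qed

lemma norm_line_direction [simp]: "norm (line_direction \<xi>) = 1"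
  using line_of_in_oriented_lines[of \<xi> 0] by (simp add: oriented_lines_def line_of_def)

lemma line_direction_surj:
  assumes "norm W = 1" "W \<noteq> south"
  obtains \<xi> where "W = line_direction \<xi>"
proof -
  define a b c where "a = W $ 1" "b = W $ 2" "c = W $ 3"
  have 1: "a\<^sup>2 + b\<^sup>2 + c\<^sup>2 = 1"
    using assms(1) by (simp add: norm_eq_sqrt_inner inner_vec_def sum_3 a_b_c_def power2_eq_square)
  have c: "1 + c \<noteq> 0"
  proof
    assume "1 + c = 0"
    then have "c = -1" by simp
    with 1 have "a\<^sup>2 + b\<^sup>2 = 0" by simp
    then have "a = 0" "b = 0" by (auto simp: sum_power2_eq_zero_iff)
    with \<open>c = -1\<close> have "W = south" by (simp add: vec_eq_iff forall_3 south_def a_b_c_def)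
    with assms(2) show False ..
  qed
  define \<xi> where "\<xi> = Complex (a / (1 + c)) (b / (1 + c))"
  have "1 + (Re \<xi>)\<^sup>2 + (Im \<xi>)\<^sup>2 = ((1 + c)\<^sup>2 + a\<^sup>2 + b\<^sup>2) / (1 + c)\<^sup>2"
    using c by (simp add: \<xi>_def power_divide add_divide_distrib)
  also have "(1 + c)\<^sup>2 + a\<^sup>2 + b\<^sup>2 = 2 * (1 + c)"
    using 1 by (simp add: power2_eq_square algebra_simps)
  also have "2 * (1 + c) / (1 + c)\<^sup>2 = 2 / (1 + c)"
    unfolding power2_eq_square by (rule nonzero_mult_divide_mult_cancel_right[OF c])
  finally have d: "1 + (Re \<xi>)\<^sup>2 + (Im \<xi>)\<^sup>2 = 2 / (1 + c)" .
  have d': "1 - (Re \<xi>)\<^sup>2 - (Im \<xi>)\<^sup>2 = 2 - 2 / (1 + c)"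
    using d by simp
  have "W = line_direction \<xi>"
    unfolding vec_eq_iff forall_3 line_direction_nth d d' using c
    by (simp add: \<xi>_def a_b_c_def field_simps)
  with that show ?thesis .
qed

lemma fibre_coordinate_line_point: "fibre_coordinate \<xi> (line_point \<xi> F 0) = F"
proof -
  define d where "d = 1 + (Re \<xi>)\<^sup>2 + (Im \<xi>)\<^sup>2"
  have nz: "d \<noteq> 0" unfolding d_def by (rule one_plus_squares_neq_0)
  have "Re F * d = Re F - (Re F * ((Re \<xi>)\<^sup>2 - (Im \<xi>)\<^sup>2) + Im F * (2 * Re \<xi> * Im \<xi>))
        + Re \<xi> * (2 * (Re F * Re \<xi> + Im F * Im \<xi>))"
    "Im F * d = Im F - (Re F * (2 * Re \<xi> * Im \<xi>) - Im F * ((Re \<xi>)\<^sup>2 - (Im \<xi>)\<^sup>2))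
        + Im \<xi> * (2 * (Re F * Re \<xi> + Im F * Im \<xi>))"
    by (simp_all add: d_def power2_eq_square algebra_simps)
  note * = this
  have aux: "d / 2 * (2 * A / d\<^sup>2 - x * (- 4 * S / d\<^sup>2)) = (A + x * (2 * S)) / d" for A x S
    using nz by (simp add: field_simps power2_eq_square)
  have "Re (fibre_coordinate \<xi> U) = d / 2 * (U $ 1 - Re \<xi> * U $ 3)"
    "Im (fibre_coordinate \<xi> U) = d / 2 * (U $ 2 - Im \<xi> * U $ 3)" for U
    by (simp_all add: fibre_coordinate_def d_def)
  note comp = this
  show ?thesis
    unfolding complex_eq_iff comp line_point_0_nth d_def[symmetric] aux *[symmetric]
    using nz by simp
qed

text \<open>
  A vector orthogonal to the direction with vanishing fibre coordinate is zero: the fibre coordinate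
  expresses its first two components through the third, and the inner product with the direction is
  then the third component.
\<close>

lemma eq_line_pointI:
  assumes "U \<bullet> line_direction \<xi> = 0" "fibre_coordinate \<xi> U = F"
  shows "U = line_point \<xi> F 0"
proof -
  define d where "d = 1 + (Re \<xi>)\<^sup>2 + (Im \<xi>)\<^sup>2"
  have nz: "d \<noteq> 0" unfolding d_def by (rule one_plus_squares_neq_0)
  define V where "V = U - line_point \<xi> F 0"
  have "line_point \<xi> F 0 \<bullet> line_direction \<xi> = 0"
    using line_of_in_oriented_lines[of \<xi> F] by (simp add: oriented_lines_def line_of_def)
  then have V: "V \<bullet> line_direction \<xi> = 0" using assms(1) by (simp add: V_def inner_diff_left)
  have "fibre_coordinate \<xi> U = fibre_coordinate \<xi> (line_point \<xi> F 0)"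
    using assms(2) fibre_coordinate_line_point by simp
  then have "Complex (U $ 1) (U $ 2) - \<xi> * of_real (U $ 3)
      = Complex (line_point \<xi> F 0 $ 1) (line_point \<xi> F 0 $ 2) - \<xi> * of_real (line_point \<xi> F 0 $ 3)"
    using nz unfolding fibre_coordinate_def d_def[symmetric] by simp
  then have 12: "V $ 1 = Re \<xi> * V $ 3" "V $ 2 = Im \<xi> * V $ 3"
    by (simp_all add: V_def complex_eq_iff algebra_simps)
  have "d * (V \<bullet> line_direction \<xi>) = V $ 3 * d"
    unfolding inner_vec_def sum_3 line_direction_nth d_def[symmetric] 12
    using nz by (simp add: field_simps) (simp add: d_def power2_eq_square algebra_simps)
  with V nz have "V $ 3 = 0" by simp
  with 12 have "V = 0" by (simp add: vec_eq_iff forall_3)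
  then show ?thesis by (simp add: V_def)
qed

lemma line_of_eq_iff: "line_of \<xi> F = line_of \<eta> G \<longleftrightarrow> \<xi> = \<eta> \<and> F = G"
  using line_direction_inj fibre_coordinate_line_point by (metis line_of_def prod.inject)

text \<open>
  In the coordinate \<open>w\<close> with \<open>\<xi> = 1 / w\<close> the tangent vector \<open>G d/dw\<close> is \<open>- G / w\<^sup>2 d/d\<xi>\<close>: the fibre
  coordinate changes as the tangent bundle of the sphere prescribes.
\<close>

lemma half_turn_line_of:
  assumes "w \<noteq> 0"
  shows "half_turn_line (line_of w G) = line_of (1 / w) (- G / w\<^sup>2)"
proof -
  define a b where "a = Re w" "b = Im w"
  define n where "n = a\<^sup>2 + b\<^sup>2"
  have n: "n > 0" using assms by (simp add: n_def a_b_def complex_eq_iff sum_power2_gt_zero_iff)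
  have n1: "1 + n \<noteq> 0" using n by simp
  have iw: "Re (1 / w) = a / n" "Im (1 / w) = - b / n"
    by (simp_all add: Re_divide Im_divide n_def a_b_def)
  have d: "1 + (Re w)\<^sup>2 + (Im w)\<^sup>2 = 1 + n" and e: "1 - (Re w)\<^sup>2 - (Im w)\<^sup>2 = 1 - n"
    by (simp_all add: n_def a_b_def)
  have "(a / n)\<^sup>2 + (b / n)\<^sup>2 = n / n\<^sup>2"
    by (simp only: power_divide add_divide_distrib[symmetric] n_def[symmetric])
  also have "\<dots> = 1 / n" using n by (simp add: power2_eq_square)
  finally have q: "(a / n)\<^sup>2 + (b / n)\<^sup>2 = 1 / n" .
  then have "1 + (a / n)\<^sup>2 + (- b / n)\<^sup>2 = 1 + 1 / n" "1 - (a / n)\<^sup>2 - (- b / n)\<^sup>2 = 1 - 1 / n"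
    by simp_all
  then have d': "1 + (a / n)\<^sup>2 + (- b / n)\<^sup>2 = (1 + n) / n"
    and d'': "1 - (a / n)\<^sup>2 - (- b / n)\<^sup>2 = (n - 1) / n"
    using n by (simp_all add: add_divide_distrib diff_divide_distrib)
  have dir: "half_turn (line_direction w) = line_direction (1 / w)"
    unfolding vec_eq_iff forall_3 half_turn_def
    unfolding line_direction_nth iw d d' d'' e vector_3 unfolding a_b_def[symmetric] using n n1
    by (simp add: divide_simps)
  have "half_turn (line_point w G 0) = line_point (1 / w) (- G / w\<^sup>2) 0"
  proof (rule eq_line_pointI)
    have "line_point w G 0 \<bullet> line_direction w = 0"
      using line_of_in_oriented_lines[of w G] by (simp add: oriented_lines_def line_of_def)
    then show "half_turn (line_point w G 0) \<bullet> line_direction (1 / w) = 0"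
      by (simp flip: dir)
    define U where "U = line_point w G 0"
    define u where "u = Complex (U $ 1) (U $ 2)"
    have G: "G = ((1 + n) / 2) *\<^sub>R (u - w * of_real (U $ 3))"
      using fibre_coordinate_line_point[of w G] by (simp add: fibre_coordinate_def U_def u_def d)
    have wn: "w * cnj w = of_real n" by (simp add: complex_mult_cnj n_def a_b_def)
    \<comment> \<open>Orthogonality of \<open>U\<close> to the direction, written with \<open>u\<close>, is what turns \<open>cnj u\<close> in the new
      coordinate into \<open>u\<close> in the old one.\<close>
    have "m * (x * (2 * a / m) + y * (2 * b / m) + z * (c / m)) = 2 * a * x + 2 * b * y + c * z"
      if "m \<noteq> 0" for m x y z c :: real
      using that by (simp add: field_simps)
    note clear = this[OF n1]
    have "(1 + n) * (U \<bullet> line_direction w) = 2 * a * U $ 1 + 2 * b * U $ 2 + (1 - n) * U $ 3"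
      unfolding inner_vec_def sum_3 line_direction_nth d e unfolding a_b_def[symmetric]
      using clear by simp
    then have "2 * a * U $ 1 + 2 * b * U $ 2 = (n - 1) * U $ 3"
      using \<open>line_point w G 0 \<bullet> line_direction w = 0\<close> by (simp add: U_def algebra_simps)
    then have orth: "cnj w * u + w * cnj u = of_real ((n - 1) * U $ 3)"
      by (simp add: complex_eq_iff u_def a_b_def algebra_simps)
    have "fibre_coordinate (1 / w) (half_turn U)
        = (((1 + n) / n) / 2) *\<^sub>R (cnj u + of_real (U $ 3) / w)"
      unfolding fibre_coordinate_def iw d' by (simp add: half_turn_def u_def complex_eq_iff)
    also have "cnj u + of_real (U $ 3) / w = - of_real n * (u - w * of_real (U $ 3)) / w\<^sup>2"
    proof -
      have "w\<^sup>2 * cnj u + w * of_real (U $ 3) = w * (of_real ((n - 1) * U $ 3) - cnj w * u) + w * of_real (U $ 3)"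
        unfolding orth[symmetric] by (simp add: power2_eq_square algebra_simps)
      also have "\<dots> = of_real n * (w * of_real (U $ 3)) - (w * cnj w) * u" by (simp add: algebra_simps)
      finally have "w\<^sup>2 * cnj u + w * of_real (U $ 3) = - of_real n * (u - w * of_real (U $ 3))"
        unfolding wn by (simp add: algebra_simps)
      moreover have "w\<^sup>2 * cnj u + w * of_real (U $ 3) = w\<^sup>2 * (cnj u + of_real (U $ 3) / w)"
        using assms by (simp add: distrib_left power2_eq_square)
      ultimately show ?thesis using assms by (metis nonzero_mult_div_cancel_left power_not_zero)
    qed
    also have "(((1 + n) / n) / 2) *\<^sub>R (- of_real n * (u - w * of_real (U $ 3)) / w\<^sup>2) = - G / w\<^sup>2"
    proof -
      have "((m / n) / 2) *\<^sub>R (- of_real n * v / k) = - ((m / 2) *\<^sub>R v) / k" for m and v k :: complex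
        using n by (simp add: scaleR_conv_of_real)
      then show ?thesis unfolding G .
    qed
    finally show "fibre_coordinate (1 / w) (half_turn (line_point w G 0)) = - G / w\<^sup>2"
      unfolding U_def .
  qed
  with dir show ?thesis by (simp add: line_of_def)
qed

text \<open>
  The section in coordinates: a globally convex congruence is, up to its single line in the South
  pole direction, the graph of \<open>F\<close>.
\<close>

definition chart_function :: "line set \<Rightarrow> (complex \<Rightarrow> complex) \<Rightarrow> bool" where
  "chart_function \<Sigma> F \<longleftrightarrow>
     smooth_on UNIV F \<and> {\<gamma>\<in>\<Sigma>. snd \<gamma> \<noteq> south} = range (\<lambda>\<xi>. line_of \<xi> (F \<xi>))"

lemma vector_3_eq_axis:
  "(vector [a, b, c] :: real^3) = a *\<^sub>R axis 1 1 + b *\<^sub>R axis 2 1 + c *\<^sub>R axis 3 1"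
  by (simp add: vec_eq_iff forall_3 axis_def)

lemma smooth_stereographic_denominator: "smooth_on UNIV (\<lambda>\<xi>::complex. 1 + (Re \<xi>)\<^sup>2 + (Im \<xi>)\<^sup>2)"
proof -
  have sq: "smooth_on UNIV (\<lambda>\<xi>::complex. (L \<xi>)\<^sup>2)" if "bounded_linear L" for L :: "complex \<Rightarrow> real"
    unfolding power2_eq_square
    using that by (intro smooth_on_bilinear[OF bounded_bilinear_mult] smooth_on_bounded_linear)
  show ?thesis
    by (intro smooth_on_add sq smooth_on_const bounded_linear_Re bounded_linear_Im)
qed

lemma smooth_line_direction: "smooth_on UNIV line_direction"
proof -
  have i: "smooth_on UNIV (\<lambda>\<xi>::complex. inverse (1 + (Re \<xi>)\<^sup>2 + (Im \<xi>)\<^sup>2))"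
    by (rule smooth_on_inverse[OF smooth_stereographic_denominator one_plus_squares_neq_0])
  have R: "smooth_on UNIV (\<lambda>\<xi>::complex. inverse (1 + (Re \<xi>)\<^sup>2 + (Im \<xi>)\<^sup>2) * (2 * Re \<xi>))"
    and I: "smooth_on UNIV (\<lambda>\<xi>::complex. inverse (1 + (Re \<xi>)\<^sup>2 + (Im \<xi>)\<^sup>2) * (2 * Im \<xi>))"
    by (intro smooth_on_bilinear[OF bounded_bilinear_mult i] smooth_on_bounded_linear
        bounded_linear_const_mult bounded_linear_Re bounded_linear_Im)+
  have "line_direction \<xi> = vector [inverse (1 + (Re \<xi>)\<^sup>2 + (Im \<xi>)\<^sup>2) * (2 * Re \<xi>),
      inverse (1 + (Re \<xi>)\<^sup>2 + (Im \<xi>)\<^sup>2) * (2 * Im \<xi>), 2 * inverse (1 + (Re \<xi>)\<^sup>2 + (Im \<xi>)\<^sup>2) + -1]" for \<xi>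
    using one_plus_squares_neq_0[of "Re \<xi>" "Im \<xi>"]
    by (simp add: vec_eq_iff forall_3 line_direction_nth divide_inverse[symmetric])
      (simp add: divide_simps)
  then have "line_direction \<xi> = (inverse (1 + (Re \<xi>)\<^sup>2 + (Im \<xi>)\<^sup>2) * (2 * Re \<xi>)) *\<^sub>R axis 1 1
     + (inverse (1 + (Re \<xi>)\<^sup>2 + (Im \<xi>)\<^sup>2) * (2 * Im \<xi>)) *\<^sub>R axis 2 1
     + (2 * inverse (1 + (Re \<xi>)\<^sup>2 + (Im \<xi>)\<^sup>2) + -1) *\<^sub>R axis 3 1" for \<xi>
    unfolding vector_3_eq_axis by simp
  moreover have "smooth_on UNIV (\<lambda>\<xi>::complex. (inverse (1 + (Re \<xi>)\<^sup>2 + (Im \<xi>)\<^sup>2) * (2 * Re \<xi>)) *\<^sub>R (axis 1 1 :: real^3)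
     + (inverse (1 + (Re \<xi>)\<^sup>2 + (Im \<xi>)\<^sup>2) * (2 * Im \<xi>)) *\<^sub>R axis 2 1
     + (2 * inverse (1 + (Re \<xi>)\<^sup>2 + (Im \<xi>)\<^sup>2) + -1) *\<^sub>R axis 3 1)"
    by (intro smooth_on_add smooth_on_bilinear[OF bounded_bilinear_scaleR]
        smooth_on_bilinear[OF bounded_bilinear_mult smooth_on_const i] R I smooth_on_const)
  ultimately show ?thesis by (metis (no_types, lifting) smooth_on_cong)
qed

lemma globally_convex_chart_function:
  assumes "globally_convex \<Sigma>"
  obtains F where "chart_function \<Sigma> F"
proof -
  obtain s where s: "smooth_on (sphere 0 1) s"
      "\<And>W. W \<in> sphere 0 1 \<Longrightarrow> s W \<in> oriented_lines \<and> snd (s W) = W" "\<Sigma> = s ` sphere 0 1"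
    using assms unfolding globally_convex_def by blast
  define u where "u = (\<lambda>\<xi>. fst (s (line_direction \<xi>)))"
  define F where "F = (\<lambda>\<xi>. fibre_coordinate \<xi> (u \<xi>))"
  have line: "line_of \<xi> (F \<xi>) = s (line_direction \<xi>)" for \<xi>
  proof -
    have "s (line_direction \<xi>) \<in> oriented_lines" "snd (s (line_direction \<xi>)) = line_direction \<xi>"
      using s(2)[of "line_direction \<xi>"] by auto
    then have "u \<xi> = line_point \<xi> (F \<xi>) 0"
      by (intro eq_line_pointI) (auto simp: u_def F_def oriented_lines_def)
    with \<open>snd (s (line_direction \<xi>)) = line_direction \<xi>\<close> show ?thesis
      by (simp add: line_of_def u_def prod_eq_iff)
  qed
  have u: "smooth_on UNIV u"
    unfolding u_def
    by (rule smooth_on_linear_compose[OF bounded_linear_fst smooth_on_compose[OF smooth_line_direction s(1)]]) auto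
  have L: "bounded_linear (\<lambda>U::real^3. Complex (U $ 1) (U $ 2))" "bounded_linear (\<lambda>U::real^3. complex_of_real (U $ 3))"
    unfolding linear_conv_bounded_linear[symmetric]
    by (auto intro!: linearI simp: complex_eq_iff)
  have "smooth_on UNIV (\<lambda>\<xi>. ((1 + (Re \<xi>)\<^sup>2 + (Im \<xi>)\<^sup>2) * (1 / 2)) *\<^sub>R
      (Complex (u \<xi> $ 1) (u \<xi> $ 2) + (- \<xi>) * of_real (u \<xi> $ 3)))"
    by (intro smooth_on_bilinear[OF bounded_bilinear_scaleR] smooth_on_add
        smooth_on_bilinear[OF bounded_bilinear_mult] smooth_on_linear_compose[OF L(1) u]
        smooth_on_linear_compose[OF L(2) u] smooth_on_const smooth_stereographic_denominator
        smooth_on_bounded_linear bounded_linear_minus bounded_linear_ident)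
  then have "smooth_on UNIV F"
    by (simp add: F_def fibre_coordinate_def)
  moreover have "{\<gamma>\<in>\<Sigma>. snd \<gamma> \<noteq> south} = range (\<lambda>\<xi>. line_of \<xi> (F \<xi>))"
  proof
    show "{\<gamma>\<in>\<Sigma>. snd \<gamma> \<noteq> south} \<subseteq> range (\<lambda>\<xi>. line_of \<xi> (F \<xi>))"
    proof
      fix \<gamma> assume "\<gamma> \<in> {\<gamma>\<in>\<Sigma>. snd \<gamma> \<noteq> south}"
      then obtain W where W: "\<gamma> = s W" "W \<in> sphere 0 1" "W \<noteq> south" using s by auto
      then obtain \<xi> where "W = line_direction \<xi>" using line_direction_surj[of W] by auto
      with W line show "\<gamma> \<in> range (\<lambda>\<xi>. line_of \<xi> (F \<xi>))" by (metis rangeI)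
    qed
    show "range (\<lambda>\<xi>. line_of \<xi> (F \<xi>)) \<subseteq> {\<gamma>\<in>\<Sigma>. snd \<gamma> \<noteq> south}"
      using line_direction_neq_south s(2,3) by (auto simp: line)
  qed
  ultimately show ?thesis using that by (simp add: chart_function_def)
qed

lemma chart_function_line_in: "chart_function \<Sigma> F \<Longrightarrow> line_of \<xi> (F \<xi>) \<in> \<Sigma>"
  unfolding chart_function_def by blast

lemma snd_line_of_neq_south: "snd (line_of \<xi> G) \<noteq> south"
  by (simp add: line_of_def line_direction_neq_south)

lemma chart_function_eq:
  assumes "chart_function \<Sigma> F" "line_of \<xi> G \<in> \<Sigma>"
  shows "G = F \<xi>"
proof -
  have "line_of \<xi> G \<in> range (\<lambda>\<xi>. line_of \<xi> (F \<xi>))"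
    using assms snd_line_of_neq_south unfolding chart_function_def by blast
  then show ?thesis by (auto simp: line_of_eq_iff)
qed

lemma chart_function_half_turn:
  assumes "chart_function \<Sigma> F" "chart_function (half_turn_line ` \<Sigma>) F'" "w \<noteq> 0"
  shows "F' w = - (w\<^sup>2 * F (1 / w))"
proof -
  have "line_of w (F' w) \<in> half_turn_line ` \<Sigma>"
    by (rule chart_function_line_in[OF assms(2)])
  then have "half_turn_line (line_of w (F' w)) \<in> \<Sigma>" by auto
  then have "- F' w / w\<^sup>2 = F (1 / w)"
    unfolding half_turn_line_of[OF assms(3)] by (rule chart_function_eq[OF assms(1)])
  then have "- F' w = F (1 / w) * w\<^sup>2" using assms(3) by (simp add: field_simps)
  then show ?thesis by (metis minus_minus mult.commute)
qed

text \<open>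
  The charts of the congruence and of its image under the half-turn cover everything; the only line
  seen in the second chart alone is the one at its origin.
\<close>

lemma globally_convex_eq_charts:
  assumes F: "chart_function \<Sigma> F" and F': "chart_function (half_turn_line ` \<Sigma>) F'"
  shows "\<Sigma> = insert (half_turn_line (line_of 0 (F' 0))) (range (\<lambda>\<xi>. line_of \<xi> (F \<xi>)))"
    and "snd (half_turn_line (line_of 0 (F' 0))) = south"
proof -
  have S: "half_turn south = line_direction 0"
    by (simp add: vec_eq_iff forall_3 half_turn_def south_def line_direction_nth)
  then show "snd (half_turn_line (line_of 0 (F' 0))) = south"
    by (metis half_turn_involution line_of_def map_prod_simp snd_conv)
  have "line_of 0 (F' 0) \<in> half_turn_line ` \<Sigma>"
    by (rule chart_function_line_in[OF F'])
  then have "half_turn_line (line_of 0 (F' 0)) \<in> \<Sigma>" by auto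
  moreover have "\<gamma> = half_turn_line (line_of 0 (F' 0))" if "\<gamma> \<in> \<Sigma>" "snd \<gamma> = south" for \<gamma>
  proof -
    have "snd (half_turn_line \<gamma>) = line_direction 0" using that S by (cases \<gamma>) auto
    then have "half_turn_line \<gamma> \<in> range (\<lambda>\<xi>. line_of \<xi> (F' \<xi>))"
      using F' that(1) line_direction_neq_south unfolding chart_function_def by (metis (mono_tags, lifting) image_eqI mem_Collect_eq)
    then obtain \<xi> where \<xi>: "half_turn_line \<gamma> = line_of \<xi> (F' \<xi>)" by auto
    with \<open>snd (half_turn_line \<gamma>) = line_direction 0\<close> have "\<xi> = 0"
      by (simp add: line_of_def line_direction_inj)
    with \<xi> show ?thesis by (metis half_turn_line_involution)
  qed
  ultimately show "\<Sigma> = insert (half_turn_line (line_of 0 (F' 0))) (range (\<lambda>\<xi>. line_of \<xi> (F \<xi>)))"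
    using F unfolding chart_function_def by blast
qed

lemma continuous_on_line_of_chart:
  assumes "smooth_on UNIV F"
  shows "continuous_on UNIV (\<lambda>\<xi>. line_of \<xi> (F \<xi>))"
proof -
  have c: "continuous_on UNIV F"
    using smooth_on_imp_C1(1)[OF open_UNIV assms] has_derivative_continuous continuous_at_imp_continuous_on by blast
  note nz = one_plus_mult_cnj_neq_0
  have "continuous_on UNIV (\<lambda>\<xi>. vector [f \<xi>, g \<xi>, h \<xi>] :: real^3)"
    if "continuous_on UNIV f" "continuous_on UNIV g" "continuous_on UNIV h" for f g h :: "complex \<Rightarrow> real"
    unfolding vector_3_eq_axis using that by (intro continuous_intros)
  note vec = this
  have "continuous_on UNIV (\<lambda>\<xi>. line_point \<xi> (F \<xi>) 0)"
    unfolding line_point_def Let_def by (intro vec continuous_intros c ballI) (simp_all add: nz)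
  moreover have "continuous_on UNIV line_direction"
    unfolding line_direction_def Let_def by (intro vec continuous_intros ballI) (simp_all add: nz)
  ultimately show ?thesis
    unfolding line_of_def by (rule continuous_on_Pair)
qed

section \<open>The shear in the stereographic chart\<close>

lemma real_linear_eq_dnu_dnubar:
  assumes "(f has_derivative D) (at z)"
  shows "D v = dnu f z * v + dnubar f z * cnj v"
proof -
  interpret linear D using assms by (rule has_derivative_linear)
  have D: "frechet_derivative f (at z) = D" using frechet_derivative_at[OF assms] by simp
  have "v = Re v *\<^sub>R 1 + Im v *\<^sub>R \<i>"
    by (simp add: complex_eq_iff)
  then have "D v = D (Re v *\<^sub>R 1 + Im v *\<^sub>R \<i>)" by (rule arg_cong)
  also have "\<dots> = Re v *\<^sub>R D 1 + Im v *\<^sub>R D \<i>"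
    by (simp only: add scaleR)
  also have "\<dots> = dnu f z * v + dnubar f z * cnj v"
    unfolding dnu_def dnubar_def D by (simp add: complex_eq_iff field_simps)
  finally show ?thesis .
qed

lemma has_derivative_dnu_dnubar:
  assumes "(f has_derivative D) (at z)"
  shows "(f has_derivative (\<lambda>v. dnu f z * v + dnubar f z * cnj v)) (at z)"
  by (rule has_derivative_eq_rhs[OF assms ext]) (rule real_linear_eq_dnu_dnubar[OF assms])

lemma dnu_dnubar_eqI:
  assumes "(f has_derivative (\<lambda>v. a * v + b * cnj v)) (at z)"
  shows "dnu f z = a" "dnubar f z = b"
  using frechet_derivative_at[OF assms, symmetric]
  by (simp_all add: dnu_def dnubar_def complex_eq_iff field_simps)

lemma dnu_dnubar_id [simp]: "dnu (\<lambda>z. z) z = 1" "dnubar (\<lambda>z. z) z = 0"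
  by (rule dnu_dnubar_eqI[where a = 1 and b = 0]; simp add: has_derivative_ident)+

lemma dnu_dnubar_cnj:
  assumes "(f has_derivative D) (at z)"
  shows "dnu (\<lambda>z. cnj (f z)) z = cnj (dnubar f z)" "dnubar (\<lambda>z. cnj (f z)) z = cnj (dnu f z)"
proof -
  have "((\<lambda>z. cnj (f z)) has_derivative (\<lambda>v. cnj (dnu f z * v + dnubar f z * cnj v))) (at z)"
    by (rule bounded_linear.has_derivative[OF bounded_linear_cnj has_derivative_dnu_dnubar[OF assms]])
  then have "((\<lambda>z. cnj (f z)) has_derivative (\<lambda>v. cnj (dnubar f z) * v + cnj (dnu f z) * cnj v)) (at z)"
    by (simp add: add.commute)
  from dnu_dnubar_eqI[OF this]
  show "dnu (\<lambda>z. cnj (f z)) z = cnj (dnubar f z)" "dnubar (\<lambda>z. cnj (f z)) z = cnj (dnu f z)" .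
qed

lemma dnu_dnubar_compose:
  assumes \<xi>: "(\<xi> has_derivative D) (at \<nu>)" and F: "(F has_derivative E) (at (\<xi> \<nu>))"
    and G: "\<forall>\<^sub>F z in nhds \<nu>. G z = F (\<xi> z)"
  shows "dnu G \<nu> = dnu F (\<xi> \<nu>) * dnu \<xi> \<nu> + dnubar F (\<xi> \<nu>) * cnj (dnubar \<xi> \<nu>)"
    and "dnubar G \<nu> = dnu F (\<xi> \<nu>) * dnubar \<xi> \<nu> + dnubar F (\<xi> \<nu>) * cnj (dnu \<xi> \<nu>)"
proof -
  obtain N where N: "open N" "\<nu> \<in> N" "\<And>z. z \<in> N \<Longrightarrow> F (\<xi> z) = G z"
    using G unfolding eventually_nhds by metis
  have "((F \<circ> \<xi>) has_derivative ((\<lambda>v. dnu F (\<xi> \<nu>) * v + dnubar F (\<xi> \<nu>) * cnj v) \<circ>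
      (\<lambda>v. dnu \<xi> \<nu> * v + dnubar \<xi> \<nu> * cnj v))) (at \<nu>)"
    by (rule diff_chain_at[OF has_derivative_dnu_dnubar[OF \<xi>] has_derivative_dnu_dnubar[OF F]])
  then have "((\<lambda>z. F (\<xi> z)) has_derivative
      (\<lambda>v. (dnu F (\<xi> \<nu>) * dnu \<xi> \<nu> + dnubar F (\<xi> \<nu>) * cnj (dnubar \<xi> \<nu>)) * v
         + (dnu F (\<xi> \<nu>) * dnubar \<xi> \<nu> + dnubar F (\<xi> \<nu>) * cnj (dnu \<xi> \<nu>)) * cnj v)) (at \<nu>)"
    by (simp add: comp_def algebra_simps)
  then have "(G has_derivative
      (\<lambda>v. (dnu F (\<xi> \<nu>) * dnu \<xi> \<nu> + dnubar F (\<xi> \<nu>) * cnj (dnubar \<xi> \<nu>)) * v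
         + (dnu F (\<xi> \<nu>) * dnubar \<xi> \<nu> + dnubar F (\<xi> \<nu>) * cnj (dnu \<xi> \<nu>)) * cnj v)) (at \<nu>)"
    by (rule has_derivative_transform_within_open[OF _ N])
  from dnu_dnubar_eqI[OF this]
  show "dnu G \<nu> = dnu F (\<xi> \<nu>) * dnu \<xi> \<nu> + dnubar F (\<xi> \<nu>) * cnj (dnubar \<xi> \<nu>)"
    and "dnubar G \<nu> = dnu F (\<xi> \<nu>) * dnubar \<xi> \<nu> + dnubar F (\<xi> \<nu>) * cnj (dnu \<xi> \<nu>)" .
qed

lemma dminus_graph [simp]: "dminus (\<lambda>z. z) F r w = dnubar F w"
  by (simp add: dminus_def)

lemma dnu_dnubar_cnj_id: "dnu cnj w = 0" "dnubar cnj w = 1"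
  using dnu_dnubar_cnj[OF has_derivative_ident[of "at w"]] by simp_all

lemma Delta_graph:
  "Delta (\<lambda>z. z) F r w = of_real (4 / (1 + (Re w)\<^sup>2 + (Im w)\<^sup>2)\<^sup>2 *
     ((cmod (dplus (\<lambda>z. z) F r w))\<^sup>2 - (cmod (dnubar F w))\<^sup>2))"
  unfolding Delta_def dminus_graph one_plus_mult_cnj unfolding complex_norm_square[symmetric] by simp

text \<open>
  With \<open>\<xi>\<close> itself as parameter the shear is the conjugate of \<open>dnubar F\<close> up to a real factor, which is
  positive at those zeros of \<open>dnubar F\<close> where \<open>Delta\<close> is nonzero.
\<close>

lemma shear_graph:
  "shear (\<lambda>z. z) F r w = cnj (dnubar F w) * of_real (1 / ((cmod (dplus (\<lambda>z. z) F r w))\<^sup>2 - (cmod (dnubar F w))\<^sup>2))"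
proof -
  have "(x * 0 - y * 1) / (of_real b - of_real a) = y * of_real (1 / (a - b))" for x y :: complex and a b
  proof -
    have "(x * 0 - y * 1) / (of_real b - of_real a) = (- y) / (- of_real (a - b))" by simp
    also have "\<dots> = y / of_real (a - b)" by (rule minus_divide_divide)
    also have "\<dots> = y * of_real (1 / (a - b))" by (simp only: of_real_divide of_real_1 times_divide_eq_right mult_1_right)
    finally show ?thesis .
  qed
  then show ?thesis
    unfolding shear_def dminus_graph dnu_dnubar_cnj_id complex_norm_square[symmetric] .
qed

lemma Delta_graph_eq_0_iff:
  "Delta (\<lambda>z. z) F r w = 0 \<longleftrightarrow> cmod (dplus (\<lambda>z. z) F r w) = cmod (dnubar F w)"
  unfolding Delta_graph of_real_eq_0_iff
  using one_plus_squares_neq_0[of "Re w" "Im w"] by (simp add: power2_eq_iff_nonneg)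

text \<open>
  A change of parameter multiplies the row \<open>(dplus, dminus)\<close> by the matrix of the derivative of \<open>\<xi>\<close>,
  whose determinant \<open>\<bar>dnu \<xi>\<bar>\<^sup>2 - \<bar>dnubar \<xi>\<bar>\<^sup>2\<close> appears once in the numerator and once in the denominator
  of the shear. Hence the shear is a function on the congruence.
\<close>

lemma
  assumes \<xi>: "(\<xi> has_derivative D) (at \<nu>)" and F: "(F has_derivative E) (at (\<xi> \<nu>))"
    and G: "\<forall>\<^sub>F z in nhds \<nu>. G z = F (\<xi> z)"
    and J: "(cmod (dnu \<xi> \<nu>))\<^sup>2 - (cmod (dnubar \<xi> \<nu>))\<^sup>2 > 0"
  shows Delta_reparametrise: "Delta \<xi> G r \<nu> = 0 \<longleftrightarrow> Delta (\<lambda>z. z) F r (\<xi> \<nu>) = 0"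
    and shear_reparametrise: "shear \<xi> G r \<nu> = shear (\<lambda>z. z) F r (\<xi> \<nu>)"
proof -
  define a b where "a = dnu \<xi> \<nu>" "b = dnubar \<xi> \<nu>"
  define P B where "P = dplus (\<lambda>z. z) F r (\<xi> \<nu>)" "B = dnubar F (\<xi> \<nu>)"
  have G0: "G \<nu> = F (\<xi> \<nu>)" using eventually_nhds_x_imp_x[OF G] .
  have P: "P = dnu F (\<xi> \<nu>) + of_real r - 2 * F (\<xi> \<nu>) * cnj (\<xi> \<nu>) / (1 + \<xi> \<nu> * cnj (\<xi> \<nu>))"
    by (simp add: P_B_def dplus_def)
  note comp = dnu_dnubar_compose[OF \<xi> F G]
  have plus: "dplus \<xi> G r \<nu> = P * a + B * cnj b"
    unfolding dplus_def comp G0 P unfolding P_B_def a_b_def by (simp add: algebra_simps)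
  have minus: "dminus \<xi> G r \<nu> = P * b + B * cnj a"
    unfolding dminus_def comp G0 P unfolding P_B_def a_b_def by (simp add: algebra_simps)
  define j where "j = a * cnj a - b * cnj b"
  have "j = of_real ((cmod a)\<^sup>2 - (cmod b)\<^sup>2)" by (simp only: j_def of_real_diff complex_norm_square)
  moreover have "(cmod a)\<^sup>2 - (cmod b)\<^sup>2 \<noteq> 0" unfolding a_b_def using J by linarith
  ultimately have j: "j \<noteq> 0" by (metis of_real_eq_0_iff)
  have det: "dplus \<xi> G r \<nu> * cnj (dplus \<xi> G r \<nu>) - dminus \<xi> G r \<nu> * cnj (dminus \<xi> G r \<nu>)
      = j * (P * cnj P - B * cnj B)"
    unfolding plus minus j_def by (simp add: algebra_simps)
  then have det': "dminus \<xi> G r \<nu> * cnj (dminus \<xi> G r \<nu>) - dplus \<xi> G r \<nu> * cnj (dplus \<xi> G r \<nu>)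
      = j * (B * cnj B - P * cnj P)"
    by (simp add: algebra_simps)
  with j one_plus_mult_cnj_neq_0[of "\<xi> \<nu>"] show "Delta \<xi> G r \<nu> = 0 \<longleftrightarrow> Delta (\<lambda>z. z) F r (\<xi> \<nu>) = 0"
    unfolding Delta_def det dminus_graph by (simp add: P_B_def)
  have num: "cnj (dplus \<xi> G r \<nu>) * cnj b - cnj (dminus \<xi> G r \<nu>) * cnj a = j * - cnj B"
    unfolding plus minus j_def by (simp add: algebra_simps)
  show "shear \<xi> G r \<nu> = shear (\<lambda>z. z) F r (\<xi> \<nu>)"
    unfolding shear_def det' dnu_dnubar_cnj[OF \<xi>] dnu_dnubar_cnj_id dminus_graph
    using num j unfolding a_b_def P_B_def by simp
qed

lemma chart_function_differentiable:
  assumes "chart_function \<Sigma> F"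
  shows "(F has_derivative frechet_derivative F (at w)) (at w)"
    "continuous_on UNIV F" "continuous_on UNIV (dnu F)" "continuous_on UNIV (dnubar F)"
proof -
  have s: "smooth_on UNIV F" using assms by (simp add: chart_function_def)
  note C1 = smooth_on_imp_C1[OF open_UNIV s]
  show "(F has_derivative frechet_derivative F (at w)) (at w)" by (rule C1) simp
  show "continuous_on UNIV F"
    using C1(1) has_derivative_continuous continuous_at_imp_continuous_on by blast
  show "continuous_on UNIV (dnu F)" "continuous_on UNIV (dnubar F)"
    unfolding dnu_def dnubar_def by (intro continuous_intros C1; simp)+
qed

lemma continuous_on_dplus_graph:
  assumes "chart_function \<Sigma> F"
  shows "continuous_on UNIV (dplus (\<lambda>z. z) F r)"
proof -
  note c = chart_function_differentiable[OF assms]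
  note nz = one_plus_mult_cnj_neq_0
  show ?thesis
    unfolding dplus_def by (intro continuous_intros c ballI) (simp_all add: nz continuous_on_const)
qed

lemma oriented_parametrisation_in_chart:
  assumes F: "chart_function \<Sigma> F" and p: "oriented_parametrisation \<Sigma> (line_of p (F p)) D \<nu>\<^sub>0 \<xi> G"
  shows "\<xi> \<nu>\<^sub>0 = p" and "\<And>\<nu>. \<nu> \<in> D \<Longrightarrow> G \<nu> = F (\<xi> \<nu>)"
    and "\<And>\<nu> r. \<nu> \<in> D \<Longrightarrow> Delta \<xi> G r \<nu> = 0 \<longleftrightarrow> Delta (\<lambda>z. z) F r (\<xi> \<nu>) = 0"
    and "\<And>\<nu> r. \<nu> \<in> D \<Longrightarrow> shear \<xi> G r \<nu> = shear (\<lambda>z. z) F r (\<xi> \<nu>)"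
proof -
  note p' = p[unfolded oriented_parametrisation_def]
  show "\<xi> \<nu>\<^sub>0 = p" using p' by (simp add: line_of_eq_iff)
  \<comment> \<open>Every line of the parametrised piece lies on the congruence, which is a graph.\<close>
  show G: "G \<nu> = F (\<xi> \<nu>)" if "\<nu> \<in> D" for \<nu>
  proof (rule chart_function_eq[OF F])
    show "line_of (\<xi> \<nu>) (G \<nu>) \<in> \<Sigma>" using p' that openin_imp_subset by fastforce
  qed
  fix \<nu> r assume \<nu>: "\<nu> \<in> D"
  have "(\<xi> has_derivative frechet_derivative \<xi> (at \<nu>)) (at \<nu>)"
    using p' \<nu> by (intro smooth_on_imp_C1) auto
  moreover have "\<forall>\<^sub>F z in nhds \<nu>. G z = F (\<xi> z)"
    unfolding eventually_nhds using p' \<nu> G by blast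
  ultimately show "Delta \<xi> G r \<nu> = 0 \<longleftrightarrow> Delta (\<lambda>z. z) F r (\<xi> \<nu>) = 0"
    "shear \<xi> G r \<nu> = shear (\<lambda>z. z) F r (\<xi> \<nu>)"
    using Delta_reparametrise[OF _ chart_function_differentiable(1)[OF F]]
      shear_reparametrise[OF _ chart_function_differentiable(1)[OF F]] p' \<nu> by blast+
qed

lemma oriented_parametrisation_graph:
  assumes F: "chart_function \<Sigma> F"
  shows "oriented_parametrisation \<Sigma> (line_of p (F p)) UNIV p (\<lambda>z. z) F"
proof -
  have "range (\<lambda>\<nu>. line_of \<nu> (F \<nu>)) = \<Sigma> \<inter> (snd -` (- {south}))"
    using F unfolding chart_function_def by blast
  moreover have "open (snd -` (- {south}) :: line set)"
    by (intro open_vimage continuous_on_snd continuous_on_id) auto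
  ultimately have "openin (top_of_set \<Sigma>) (range (\<lambda>\<nu>. line_of \<nu> (F \<nu>)))"
    by (metis openin_open)
  then show ?thesis
    using F unfolding oriented_parametrisation_def chart_function_def
    by (auto simp: smooth_on_id inj_on_def line_of_eq_iff)
qed

text \<open>
  Moving far along a line, \<open>dplus\<close> grows while \<open>dminus\<close> stays fixed.
\<close>

lemma exists_Delta_graph_neq_0: "\<exists>r. Delta (\<lambda>z. z) F r w \<noteq> 0"
proof -
  define c where "c = dnu F w - 2 * F w * cnj w / (1 + w * cnj w)"
  have c: "dplus (\<lambda>z. z) F r w = c + of_real r" for r
    by (simp add: dplus_def c_def)
  define r where "r = cmod c + cmod (dnubar F w) + 1"
  have "cmod (of_real r) \<le> cmod (c + of_real r) + cmod c"
    by (metis add.commute add_diff_cancel_left' norm_triangle_sub norm_minus_commute norm_triangle_ineq4)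
  moreover have "cmod (of_real r) = \<bar>r\<bar>" by (rule norm_of_real)
  moreover have "r \<ge> cmod c + cmod (dnubar F w) + 1" by (simp add: r_def)
  ultimately have "cmod (dplus (\<lambda>z. z) F r w) \<noteq> cmod (dnubar F w)"
    unfolding c by linarith
  then show ?thesis unfolding Delta_graph_eq_0_iff by blast
qed

text \<open>
  By reparametrisation invariance it is enough to test the parametrisation by \<open>\<xi>\<close>, at a point of the
  line where \<open>Delta\<close> is nonzero.
\<close>

lemma shear_free_in_chart:
  assumes F: "chart_function \<Sigma> F"
  shows "(\<forall>D \<nu>\<^sub>0 \<xi> G r. oriented_parametrisation \<Sigma> (line_of p (F p)) D \<nu>\<^sub>0 \<xi> G \<and> Delta \<xi> G r \<nu>\<^sub>0 \<noteq> 0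
            \<longrightarrow> shear \<xi> G r \<nu>\<^sub>0 = 0) \<longleftrightarrow> dnubar F p = 0" (is "?L \<longleftrightarrow> _")
proof
  assume ?L
  moreover obtain r where r: "Delta (\<lambda>z. z) F r p \<noteq> 0" using exists_Delta_graph_neq_0 by blast
  ultimately have "shear (\<lambda>z. z) F r p = 0" using oriented_parametrisation_graph[OF F] by blast
  then show "dnubar F p = 0"
    using r unfolding shear_graph Delta_graph_eq_0_iff mult_eq_0_iff of_real_eq_0_iff
    by (simp add: power2_eq_iff_nonneg)
next
  assume 0: "dnubar F p = 0"
  show ?L
  proof (intro allI impI)
    fix D \<nu>\<^sub>0 \<xi> G r
    assume "oriented_parametrisation \<Sigma> (line_of p (F p)) D \<nu>\<^sub>0 \<xi> G \<and> Delta \<xi> G r \<nu>\<^sub>0 \<noteq> 0"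
    then have *: "oriented_parametrisation \<Sigma> (line_of p (F p)) D \<nu>\<^sub>0 \<xi> G" by simp
    then have "\<nu>\<^sub>0 \<in> D" by (simp add: oriented_parametrisation_def)
    then show "shear \<xi> G r \<nu>\<^sub>0 = 0"
      using oriented_parametrisation_in_chart[OF F *] 0 by (simp add: shear_graph)
  qed
qed

text \<open>
  Near an isolated zero of \<open>dnubar F\<close> the shear is \<open>cnj (dnubar F)\<close> times a positive function. The
  conjugation turns the sign of the winding number, which the sign in the definition of the index
  undoes.
\<close>

lemma shear_index_in_chart:
  assumes F: "chart_function \<Sigma> F" and 0: "dnubar F p = 0"
    and iso: "\<forall>\<^sub>F w in at p. dnubar F w \<noteq> 0"
  shows "(\<forall>D \<nu>\<^sub>0 \<xi> G r. oriented_parametrisation \<Sigma> (line_of p (F p)) D \<nu>\<^sub>0 \<xi> G \<and> Delta \<xi> G r \<nu>\<^sub>0 \<noteq> 0 \<longrightarrow>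
            (\<forall>\<^sub>F \<epsilon> in at_right 0. winding_number (shear \<xi> G r \<circ> circlepath \<nu>\<^sub>0 \<epsilon>) 0 = - of_int k))
          \<longleftrightarrow> k = zero_index (dnubar F) p" (is "?L \<longleftrightarrow> _")
proof -
  have main: "\<forall>\<^sub>F \<epsilon> in at_right 0. winding_number (shear \<xi> G r \<circ> circlepath \<nu>\<^sub>0 \<epsilon>) 0 = - of_int (zero_index (dnubar F) p)"
    if par: "oriented_parametrisation \<Sigma> (line_of p (F p)) D \<nu>\<^sub>0 \<xi> G" and "Delta \<xi> G r \<nu>\<^sub>0 \<noteq> 0" for D \<nu>\<^sub>0 \<xi> G r
  proof -
    note par' = par[unfolded oriented_parametrisation_def]
    note chart = oriented_parametrisation_in_chart[OF F par]
    define P where "P = (\<lambda>w. (cmod (dplus (\<lambda>z. z) F r w))\<^sup>2 - (cmod (dnubar F w))\<^sup>2)"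
    define S where "S = shear (\<lambda>z. z) F r"
    have S: "S w = cnj (dnubar F w) * of_real (1 / P w)" for w
      unfolding S_def P_def shear_graph ..
    have Pc: "continuous_on UNIV P"
      unfolding P_def by (intro continuous_intros continuous_on_dplus_graph[OF F] chart_function_differentiable[OF F])
    have "Delta (\<lambda>z. z) F r p \<noteq> 0" using that(2) chart(1,3) par' by metis
    then have "P p > 0" using 0 by (simp add: P_def Delta_graph_eq_0_iff)
    moreover have "(P \<longlongrightarrow> P p) (at p)"
      using Pc by (simp add: continuous_on_eq_continuous_at isCont_def)
    ultimately have "\<forall>\<^sub>F w in at p. P w > 0" by (simp add: order_tendsto_iff)
    with iso have "\<forall>\<^sub>F w in at p. dnubar F w \<noteq> 0 \<and> P w > 0" by (rule eventually_conj)
    then obtain \<delta> where \<delta>: "\<delta> > 0" "\<And>w. w \<noteq> p \<Longrightarrow> dist w p < \<delta> \<Longrightarrow> dnubar F w \<noteq> 0 \<and> P w > 0"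
      unfolding eventually_at by blast
    have Bc: "continuous_on A (dnubar F)" for A
      using chart_function_differentiable(4)[OF F] by (rule continuous_on_subset) simp
    have P0: "P w > 0" if "w \<in> ball p \<delta>" for w
      using that \<delta>(2)[of w] \<open>P p > 0\<close> by (cases "w = p") (auto simp: dist_commute)
    have B0: "dnubar F w \<noteq> 0" if "w \<in> ball p \<delta> - {p}" for w
      using that \<delta>(2)[of w] by (auto simp: dist_commute)
    have Qc: "continuous_on A (\<lambda>w. complex_of_real (1 / P w))" if "A \<subseteq> ball p \<delta>" for A
    proof -
      have "P w \<noteq> 0" if "w \<in> A" for w using P0[of w] that \<open>A \<subseteq> ball p \<delta>\<close> by auto
      then show ?thesis by (intro continuous_intros continuous_on_subset[OF Pc]) auto
    qed
    have Sc: "continuous_on (ball p \<delta> - {p}) S"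
      unfolding S[abs_def] by (intro continuous_on_mult continuous_on_cnj Bc Qc) auto
    have "zero_index S p = zero_index (\<lambda>w. cnj (dnubar F w)) p"
    proof (rule zero_index_mult_nonvanishing[OF _ _ Qc[OF order_refl] _ S \<open>\<delta> > 0\<close>])
      show "cnj (dnubar F w) \<noteq> 0" if "w \<in> ball p \<delta> - {p}" for w using B0[OF that] by simp
      show "complex_of_real (1 / P w) \<noteq> 0" if "w \<in> ball p \<delta>" for w using P0[OF that] by simp
    qed (intro continuous_on_cnj Bc)
    then have idx: "zero_index S p = - zero_index (dnubar F) p"
      using zero_index_cnj[OF Bc B0 \<delta>(1)] by simp
    have S0: "S w \<noteq> 0" if "w \<in> ball p \<delta> - {p}" for w
      using that B0[of w] P0[of w] by (auto simp: S)
    have D: "open D" "\<nu>\<^sub>0 \<in> D" "smooth_on D \<xi>" using par' by auto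
    note C1 = smooth_on_imp_C1[OF D(1,3)]
    have "\<forall>\<^sub>F \<epsilon> in at_right 0. winding_number ((\<lambda>w. S (\<xi> w)) \<circ> circlepath \<nu>\<^sub>0 \<epsilon>) 0 = of_int (zero_index S (\<xi> \<nu>\<^sub>0))"
    proof (rule winding_number_local_diffeomorphism[OF has_derivative_dnu_dnubar[OF C1(1)[OF D(2)]] _ D(1,2)])
      have "(cmod (dnubar \<xi> \<nu>\<^sub>0))\<^sup>2 < (cmod (dnu \<xi> \<nu>\<^sub>0))\<^sup>2" using par' D(2) by force
      then show "cmod (dnubar \<xi> \<nu>\<^sub>0) < cmod (dnu \<xi> \<nu>\<^sub>0)" by (rule power2_less_imp_less) simp
      show "continuous_on D \<xi>"
        using C1(1) has_derivative_continuous continuous_at_imp_continuous_on by blast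
    qed (use Sc S0 \<delta> chart(1) in auto)
    moreover obtain e where e: "e > 0" "ball \<nu>\<^sub>0 e \<subseteq> D" using D by (meson open_contains_ball)
    have "\<forall>\<^sub>F \<epsilon> in at_right 0. winding_number (shear \<xi> G r \<circ> circlepath \<nu>\<^sub>0 \<epsilon>) 0
        = winding_number ((\<lambda>w. S (\<xi> w)) \<circ> circlepath \<nu>\<^sub>0 \<epsilon>) 0"
      unfolding eventually_at_right_field
    proof (intro exI[of _ e] conjI allI impI)
      fix \<epsilon> assume \<epsilon>: "0 < \<epsilon>" "\<epsilon> < e"
      show "winding_number (shear \<xi> G r \<circ> circlepath \<nu>\<^sub>0 \<epsilon>) 0 = winding_number ((\<lambda>w. S (\<xi> w)) \<circ> circlepath \<nu>\<^sub>0 \<epsilon>) 0"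
      proof (rule winding_number_cong)
        fix t :: real assume "0 \<le> t" "t \<le> 1"
        then have "circlepath \<nu>\<^sub>0 \<epsilon> t \<in> sphere \<nu>\<^sub>0 \<epsilon>"
          using \<epsilon> by (intro circlepath_in_sphere) auto
        then have "circlepath \<nu>\<^sub>0 \<epsilon> t \<in> D" using e \<epsilon> by auto
        then show "(shear \<xi> G r \<circ> circlepath \<nu>\<^sub>0 \<epsilon>) t = ((\<lambda>w. S (\<xi> w)) \<circ> circlepath \<nu>\<^sub>0 \<epsilon>) t"
          using chart(4) by (simp add: S_def)
      qed
    qed (fact e)
    ultimately show ?thesis
      by eventually_elim (simp add: chart(1) idx)
  qed
  show ?thesis
  proof
    assume ?L
    moreover obtain r where r: "Delta (\<lambda>z. z) F r p \<noteq> 0" using exists_Delta_graph_neq_0 by blast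
    ultimately have "\<forall>\<^sub>F \<epsilon> in at_right 0. winding_number (shear (\<lambda>z. z) F r \<circ> circlepath p \<epsilon>) 0 = - of_int k"
      using oriented_parametrisation_graph[OF F] by blast
    with main[OF oriented_parametrisation_graph[OF F] r]
    have "\<forall>\<^sub>F \<epsilon> in at_right (0::real). k = zero_index (dnubar F) p"
      by eventually_elim (metis neg_equal_iff_equal of_int_eq_iff)
    then show "k = zero_index (dnubar F) p" by simp
  qed (use main in blast)
qed

section \<open>Counting the shear-free lines\<close>

lemma shear_free_chart_iff:
  assumes F: "chart_function \<Sigma> F"
  shows "shear_free \<Sigma> (line_of p (F p)) \<longleftrightarrow> dnubar F p = 0"
  using shear_free_in_chart[OF F] snd_line_of_neq_south
  unfolding shear_free_def parametrisation_around_def chart_rotation_def by simp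

lemma shear_free_south_iff:
  assumes F': "chart_function (half_turn_line ` \<Sigma>) F'" and "snd (half_turn_line (line_of 0 (F' 0))) = south"
  shows "shear_free \<Sigma> (half_turn_line (line_of 0 (F' 0))) \<longleftrightarrow> dnubar F' 0 = 0"
  using shear_free_in_chart[OF F', of 0] assms(2)
  unfolding shear_free_def parametrisation_around_def chart_rotation_def by simp

lemma shear_index_chart:
  assumes F: "chart_function \<Sigma> F" "dnubar F p = 0" "\<forall>\<^sub>F w in at p. dnubar F w \<noteq> 0"
  shows "shear_index \<Sigma> (line_of p (F p)) = zero_index (dnubar F) p"
proof -
  have "has_shear_index \<Sigma> (line_of p (F p)) k \<longleftrightarrow> k = zero_index (dnubar F) p" for k
    using shear_index_in_chart[OF F, of k] snd_line_of_neq_south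
    unfolding has_shear_index_def parametrisation_around_def chart_rotation_def by simp
  then show ?thesis unfolding shear_index_def by (intro the_equality) auto
qed

lemma shear_index_south:
  assumes F': "chart_function (half_turn_line ` \<Sigma>) F'" "dnubar F' 0 = 0" "\<forall>\<^sub>F w in at 0. dnubar F' w \<noteq> 0"
    and "snd (half_turn_line (line_of 0 (F' 0))) = south"
  shows "shear_index \<Sigma> (half_turn_line (line_of 0 (F' 0))) = zero_index (dnubar F') 0"
proof -
  have "has_shear_index \<Sigma> (half_turn_line (line_of 0 (F' 0))) k \<longleftrightarrow> k = zero_index (dnubar F') 0" for k
    using shear_index_in_chart[OF F', of k] assms(4)
    unfolding has_shear_index_def parametrisation_around_def chart_rotation_def by simp
  then show ?thesis unfolding shear_index_def by (intro the_equality) auto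
qed

text \<open>
  In \<open>F' w = - w\<^sup>2 F (1 / w)\<close> the factor \<open>w\<^sup>2\<close> and the inner map are holomorphic, so that \<open>dnubar\<close> acts on
  \<open>F\<close> alone and brings out the conjugate of the derivative \<open>- 1 / w\<^sup>2\<close> of the inner map.
\<close>

lemma dnubar_half_turn:
  assumes F: "chart_function \<Sigma> F" and F': "chart_function (half_turn_line ` \<Sigma>) F'" and w: "w \<noteq> 0"
  shows "dnubar F' w = (w / cnj w)\<^sup>2 * dnubar F (1 / w)"
proof -
  define \<alpha> \<beta> where "\<alpha> = dnu F (1 / w)" "\<beta> = dnubar F (1 / w)"
  have 1: "((\<lambda>z. 1 / z) has_derivative (\<lambda>v. - (v / w\<^sup>2))) (at w)"
    using w by (auto intro!: derivative_eq_intros simp: fun_eq_iff field_simps power2_eq_square)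
  have 2: "(F has_derivative (\<lambda>v. \<alpha> * v + \<beta> * cnj v)) (at (1 / w))"
    unfolding \<alpha>_\<beta>_def by (rule has_derivative_dnu_dnubar[OF chart_function_differentiable(1)[OF F]])
  have 3: "((\<lambda>z. F (1 / z)) has_derivative (\<lambda>v. \<alpha> * - (v / w\<^sup>2) + \<beta> * cnj (- (v / w\<^sup>2)))) (at w)"
    using diff_chain_at[OF 1 2] by (simp add: comp_def)
  have "((\<lambda>z. - (z\<^sup>2 * F (1 / z))) has_derivative
      (\<lambda>v. - (w\<^sup>2 * (\<alpha> * - (v / w\<^sup>2) + \<beta> * cnj (- (v / w\<^sup>2))) + (2 * w * v) * F (1 / w)))) (at w)"
    by (intro has_derivative_minus has_derivative_mult 3) (auto intro!: derivative_eq_intros)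
  moreover have "- (w\<^sup>2 * (\<alpha> * - (v / w\<^sup>2) + \<beta> * cnj (- (v / w\<^sup>2))) + (2 * w * v) * F (1 / w))
      = (\<alpha> - 2 * w * F (1 / w)) * v + ((w / cnj w)\<^sup>2 * \<beta>) * cnj v" for v
    using w by (simp add: field_simps)
  ultimately have "((\<lambda>z. - (z\<^sup>2 * F (1 / z))) has_derivative
      (\<lambda>v. (\<alpha> - 2 * w * F (1 / w)) * v + ((w / cnj w)\<^sup>2 * \<beta>) * cnj v)) (at w)"
    by simp
  then have "(F' has_derivative (\<lambda>v. (\<alpha> - 2 * w * F (1 / w)) * v + ((w / cnj w)\<^sup>2 * \<beta>) * cnj v)) (at w)"
    by (rule has_derivative_transform_within_open[of _ _ _ _ "- {0}"])
      (use w chart_function_half_turn[OF F F'] in auto)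
  from dnu_dnubar_eqI(2)[OF this] show ?thesis by (simp add: \<alpha>_\<beta>_def)
qed

text \<open>
  On the circle of radius \<open>1 / R\<close> the transition factor \<open>(w / cnj w)\<^sup>2\<close> is \<open>exp (4 i t)\<close> at angle \<open>t\<close>, and
  \<open>1 / w\<close> runs through the circle of radius \<open>R\<close> backwards. The number 4 is the degree of the bundle of
  which \<open>dnubar F\<close> is a section, the tangent bundle tensored with the antiholomorphic cotangent bundle.
\<close>

lemma winding_number_transition:
  assumes F: "chart_function \<Sigma> F" and F': "chart_function (half_turn_line ` \<Sigma>) F'"
    and R: "R > 0" and nz: "\<And>z. z \<in> sphere 0 R \<Longrightarrow> dnubar F z \<noteq> 0"
  shows "winding_number (dnubar F' \<circ> circlepath 0 (1 / R)) 0 + winding_number (dnubar F \<circ> circlepath 0 R) 0 = 4"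
proof -
  define q where "q = reversepath (dnubar F \<circ> circlepath 0 R)"
  have Bc: "continuous_on A (dnubar F)" for A
    using chart_function_differentiable(4)[OF F] by (rule continuous_on_subset) simp
  have pB: "path (dnubar F \<circ> circlepath 0 R)" "0 \<notin> path_image (dnubar F \<circ> circlepath 0 R)"
    using R nz by (force simp: path_image_comp_circlepath intro!: path_comp_circlepath Bc)+
  have "winding_number (dnubar F' \<circ> circlepath 0 (1 / R)) 0
      = winding_number (\<lambda>t. exp (8 * of_real pi * \<i> * of_real t) * q t) 0"
  proof (rule winding_number_cong)
    fix t :: real
    define e where "e = exp (2 * of_real pi * \<i> * of_real t)"
    have ce: "cnj e = 1 / e" by (simp add: e_def exp_cnj exp_minus inverse_eq_divide)
    have c: "circlepath 0 (1 / R) t = e / of_real R" by (simp add: circlepath e_def)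
    have "2 * of_real pi * \<i> * of_real (1 - t) = 2 * of_real pi * \<i> - 2 * of_real pi * \<i> * of_real t"
      by (simp add: algebra_simps)
    then have "exp (2 * of_real pi * \<i> * of_real (1 - t)) = 1 / e"
      by (simp only: exp_diff exp_two_pi_i e_def)
    then have c': "circlepath 0 R (1 - t) = 1 / (e / of_real R)" by (simp add: circlepath)
    have nz: "e \<noteq> 0" by (simp add: e_def)
    have "(e / of_real R / cnj (e / of_real R))\<^sup>2 = e ^ 4"
      using R nz by (simp add: ce power2_eq_square power4_eq_xxxx)
    also have "\<dots> = exp (8 * of_real pi * \<i> * of_real t)"
      unfolding e_def by (simp flip: exp_of_nat_mult add: algebra_simps)
    finally show "(dnubar F' \<circ> circlepath 0 (1 / R)) t = exp (8 * of_real pi * \<i> * of_real t) * q t"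
      using R nz by (simp add: c c' q_def reversepath_def dnubar_half_turn[OF F F'])
  qed
  also have "\<dots> = winding_number (\<lambda>t. exp (8 * of_real pi * \<i> * of_real t)) 0 + winding_number q 0"
  proof (rule winding_number_mult)
    show "path (\<lambda>t. exp (8 * complex_of_real pi * \<i> * of_real t))"
      unfolding path_def by (intro continuous_intros)
    show "0 \<notin> path_image (\<lambda>t. exp (8 * complex_of_real pi * \<i> * of_real t))"
      by (auto simp: path_image_def)
    show "path q" "0 \<notin> path_image q" using pB by (simp_all add: q_def)
  qed
  also have "winding_number (\<lambda>t. exp (8 * of_real pi * \<i> * of_real t)) 0
      = (pathfinish (\<lambda>t. 8 * of_real pi * \<i> * of_real t) - pathstart (\<lambda>t. 8 * of_real pi * \<i> * of_real t))
        / (2 * of_real pi * \<i>)"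
    by (rule winding_number_exp_path) (auto simp: path_def intro!: continuous_intros)
  also have "\<dots> = 4" by (simp add: pathfinish_def pathstart_def)
  also have "winding_number q 0 = - winding_number (dnubar F \<circ> circlepath 0 R) 0"
    unfolding q_def by (rule winding_number_reversepath[OF pB])
  finally show ?thesis by (simp add: comp_def)
qed

theorem theorem3:
  fixes \<Sigma> :: "line set"
  assumes "globally_convex \<Sigma>"
    and "\<And>\<gamma>. \<gamma> \<in> shear_free_lines \<Sigma> \<Longrightarrow> \<gamma> isolated_in shear_free_lines \<Sigma>"
  shows "finite (shear_free_lines \<Sigma>) \<and> (\<Sum>\<gamma>\<in>shear_free_lines \<Sigma>. shear_index \<Sigma> \<gamma>) = 4"
proof -
  obtain F where F: "chart_function \<Sigma> F"
    using globally_convex_chart_function[OF assms(1)] .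
  obtain F' where F': "chart_function (half_turn_line ` \<Sigma>) F'"
    using globally_convex_chart_function[OF globally_convex_half_turn[OF assms(1)]] .
  define g where "g = (\<lambda>p. line_of p (F p))"
  define g' where "g' = (\<lambda>w. half_turn_line (line_of w (F' w)))"
  note south = globally_convex_eq_charts(2)[OF F F']
  have \<Sigma>: "\<Sigma> = insert (g' 0) (range g)"
    unfolding g_def g'_def by (rule globally_convex_eq_charts(1)[OF F F'])
  define Z where "Z = {p. dnubar F p = 0}"
  have SF: "shear_free_lines \<Sigma> = g ` Z \<union> (if dnubar F' 0 = 0 then {g' 0} else {})"
  proof -
    have "\<gamma> \<in> shear_free_lines \<Sigma> \<longleftrightarrow> (\<gamma> = g' 0 \<and> dnubar F' 0 = 0) \<or> (\<exists>p\<in>Z. \<gamma> = g p)" for \<gamma>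
      using shear_free_chart_iff[OF F] shear_free_south_iff[OF F' south] \<Sigma>
      unfolding shear_free_lines_def Z_def g_def g'_def by blast
    then show ?thesis by auto
  qed
  have g_south: "g p \<noteq> g' 0" for p
    using south snd_line_of_neq_south by (metis g_def g'_def)
  have gg': "g' w = g (1 / w)" if "w \<noteq> 0" for w
    using half_turn_line_of[OF that] chart_function_half_turn[OF F F' that] that by (simp add: g_def g'_def)
  have B'B: "dnubar F' w = 0 \<longleftrightarrow> 1 / w \<in> Z" if "w \<noteq> 0" for w
    using dnubar_half_turn[OF F F' that] that by (simp add: Z_def)
  have gc: "continuous_on UNIV g"
    unfolding g_def using F by (intro continuous_on_line_of_chart) (simp add: chart_function_def)
  have g'c: "continuous_on UNIV g'"
  proof -
    have "continuous_on UNIV half_turn" using linear_half_turn by (rule linear_continuous_on[OF linear_conv_bounded_linear[THEN iffD1]])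
    then have h: "continuous_on A half_turn" for A by (rule continuous_on_subset) simp
    have c: "continuous_on UNIV (\<lambda>w. line_of w (F' w))"
      using F' by (intro continuous_on_line_of_chart) (simp add: chart_function_def)
    show ?thesis
      unfolding g'_def map_prod_def case_prod_unfold
      by (intro continuous_on_Pair continuous_on_compose2[OF h] continuous_on_fst continuous_on_snd c) auto
  qed
  have Bc: "continuous_on A (dnubar F)" "continuous_on A (dnubar F')" for A
    using chart_function_differentiable(4)[OF F] chart_function_differentiable(4)[OF F']
    by (auto intro: continuous_on_subset)
  \<comment> \<open>Isolation of the shear-free lines makes the zeros in both charts isolated.\<close>
  have "\<forall>\<^sub>F w in at 0. dnubar F' w \<noteq> 0"
  proof (cases "dnubar F' 0 = 0")
    case True
    then have "g' 0 isolated_in shear_free_lines \<Sigma>" using SF by (intro assms(2)) auto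
    then obtain T where T: "open T" "T \<inter> shear_free_lines \<Sigma> = {g' 0}" by (auto elim: isolated_inE)
    have "(g' \<longlongrightarrow> g' 0) (at 0)" using g'c by (simp add: continuous_on_eq_continuous_at isCont_def)
    then have "\<forall>\<^sub>F w in at 0. g' w \<in> T" by (rule topological_tendstoD) (use T in auto)
    moreover have "\<forall>\<^sub>F w in at (0::complex). w \<noteq> 0" by (simp add: eventually_at_filter)
    ultimately show ?thesis
    proof eventually_elim
      case (elim w)
      show ?case
      proof
        assume "dnubar F' w = 0"
        then have "g' w \<in> shear_free_lines \<Sigma>" using B'B elim gg' SF by auto
        with elim T have "g' w = g' 0" by blast
        with elim gg' g_south show False by metis
      qed
    qed
  next
    case False
    have "(dnubar F' \<longlongrightarrow> dnubar F' 0) (at 0)" using Bc(2)[of UNIV] by (simp add: continuous_on_eq_continuous_at isCont_def)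
    then show ?thesis using False by (rule tendsto_imp_eventually_ne)
  qed
  note iso' = this
  have iso: "\<forall>\<^sub>F w in at p. dnubar F w \<noteq> 0" if "p \<in> Z" for p
  proof -
    have "g p isolated_in shear_free_lines \<Sigma>" using SF that by (intro assms(2)) auto
    then obtain T where T: "open T" "T \<inter> shear_free_lines \<Sigma> = {g p}" by (auto elim: isolated_inE)
    have "(g \<longlongrightarrow> g p) (at p)" using gc by (simp add: continuous_on_eq_continuous_at isCont_def)
    then have "\<forall>\<^sub>F w in at p. g w \<in> T" by (rule topological_tendstoD) (use T in auto)
    moreover have "\<forall>\<^sub>F w in at p. w \<noteq> p" by (simp add: eventually_at_filter)
    ultimately show ?thesis
    proof eventually_elim
      case (elim w)
      show ?case
      proof
        assume "dnubar F w = 0"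
        then have "g w \<in> T \<inter> shear_free_lines \<Sigma>" using elim SF by (auto simp: Z_def)
        with T elim show False by (auto simp: g_def line_of_eq_iff)
      qed
    qed
  qed
  \<comment> \<open>A punctured neighbourhood of the South pole without zeros confines all zeros in the first chart
    to a disc; compactness makes them finite in number.\<close>
  obtain \<delta> where \<delta>: "\<delta> > 0" "\<And>w. w \<noteq> 0 \<Longrightarrow> cmod w < \<delta> \<Longrightarrow> dnubar F' w \<noteq> 0"
    using iso' unfolding eventually_at by auto
  have bound: "cmod p \<le> 1 / \<delta>" if "p \<in> Z" for p
  proof (rule ccontr)
    assume "\<not> cmod p \<le> 1 / \<delta>"
    then have "1 / \<delta> < cmod p" by simp
    moreover from this \<delta>(1) have "p \<noteq> 0" by (auto simp: field_simps)
    ultimately have "1 / p \<noteq> 0" "cmod (1 / p) < \<delta>" using \<delta>(1) by (auto simp: norm_divide field_simps)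
    then show False using \<delta>(2)[of "1 / p"] B'B[of "1 / p"] that by simp
  qed
  have "finite Z"
  proof -
    have "closed Z" unfolding Z_def
      using continuous_closed_preimage_constant[OF Bc(1)[of UNIV] closed_UNIV, of 0] by simp
    moreover have "bounded Z" using bound by (auto simp: bounded_iff)
    ultimately have "compact Z" by (simp add: compact_eq_bounded_closed)
    moreover have "\<not> p islimpt Z" if "p \<in> Z" for p
      using iso[OF that] by (simp add: islimpt_iff_eventually Z_def)
    ultimately show ?thesis using finite_not_islimpt_in_compact[of Z Z] by simp
  qed
  \<comment> \<open>Any radius beyond \<open>1 / \<delta>\<close> gives a circle that encloses the zeros of the first chart and, seen from
    the second, lies in the punctured disc where only \<open>0\<close> can be a zero.\<close>
  define R where "R = 2 / \<delta>"
  have R: "R > 0" "1 / R < \<delta>" using \<delta>(1) by (auto simp: R_def)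
  have ZR: "Z \<subseteq> ball 0 R"
  proof
    fix p assume "p \<in> Z"
    then have "cmod p \<le> 1 / \<delta>" by (rule bound)
    also have "\<dots> < R" using \<delta>(1) by (simp add: R_def divide_strict_right_mono)
    finally show "p \<in> ball 0 R" by simp
  qed
  have "winding_number (dnubar F \<circ> circlepath 0 R) 0 = of_int (\<Sum>p\<in>Z. zero_index (dnubar F) p)"
    by (rule winding_number_eq_sum_zero_index[OF \<open>finite Z\<close> ZR R(1) Bc(1)]) (auto simp: Z_def)
  moreover have "winding_number (dnubar F' \<circ> circlepath 0 (1 / R)) 0 = of_int (zero_index (dnubar F') 0)"
    using R \<delta> by (intro winding_number_eq_zero_index[of 0 \<delta>] Bc(2)) auto
  moreover have "winding_number (dnubar F' \<circ> circlepath 0 (1 / R)) 0 + winding_number (dnubar F \<circ> circlepath 0 R) 0 = 4"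
    using ZR by (intro winding_number_transition[OF F F' R(1)]) (auto simp: Z_def)
  ultimately have "of_int (zero_index (dnubar F') 0 + (\<Sum>p\<in>Z. zero_index (dnubar F) p)) = (of_int 4 :: complex)"
    by simp
  then have total: "zero_index (dnubar F') 0 + (\<Sum>p\<in>Z. zero_index (dnubar F) p) = 4"
    by (simp only: of_int_eq_iff)
  have "(\<Sum>\<gamma>\<in>g ` Z. shear_index \<Sigma> \<gamma>) = (\<Sum>p\<in>Z. shear_index \<Sigma> (g p))"
    by (rule sum.reindex_cong[of g]) (auto simp: inj_on_def g_def line_of_eq_iff)
  also have "\<dots> = (\<Sum>p\<in>Z. zero_index (dnubar F) p)"
    using shear_index_chart[OF F _ iso] by (intro sum.cong) (auto simp: g_def Z_def)
  finally have sum: "(\<Sum>\<gamma>\<in>g ` Z. shear_index \<Sigma> \<gamma>) = (\<Sum>p\<in>Z. zero_index (dnubar F) p)" .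
  have g'Z: "g' 0 \<notin> g ` Z" using g_south by (metis imageE)
  show ?thesis
  proof (cases "dnubar F' 0 = 0")
    case True
    then have "shear_index \<Sigma> (g' 0) = zero_index (dnubar F') 0"
      unfolding g'_def by (rule shear_index_south[OF F' _ iso' south])
    then show ?thesis
      using True SF sum total g'Z \<open>finite Z\<close> by simp
  next
    case False
    then have "zero_index (dnubar F') 0 = 0" by (intro zero_index_nonzero[of 0 1] Bc(2)) auto
    then show ?thesis
      using False SF sum total \<open>finite Z\<close> by simp
  qed
qed

end
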